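(* The map $$P\mapsto\bigl(P_{21}{P_{11}}^{-1},\ \ker P_{11}\bigr)$$ is a bijection from $\mathfrak P_{P_1}$ onto $\tilde{\mathfrak P}_{P_1}$, with inverse given by $$(T,\mathfrak h)\mapsto P_{(T,\mathfrak h)}:=P_T-p_{\mathfrak h}+\overline{p_{\mathfrak h}}.$$ Here ${P_{11}}^{-1}\in\mathfrak B(\mathcal K_1)$ is defined as the inverse of $P_{11}$ on the closed subspace $\operatorname{ran}P_{11}$ and as zero on the finite-dimensional subspace $\ker P_{11}$; $P_T$ is the (basis) projection onto $\operatorname{ran}(P_1+T)$, $$P_T=(P_1+T)(P_1+T^*T)^{-1}(P_1+T^* ),$$ and $p_{\mathfrak h}$ is the orthogonal projection onto $\mathfrak h\subset\mathcal K_1$.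
   Context: Let $\mathcal K$ be an infinite-dimensional separable complex Hilbert space with a complex conjugation $f\mapsto f^*$ (an antiunitary involution). For a bounded operator $A$ put $\overline{A}f=(A(f^* ))^*$ and $A^\tau=\overline{A^*}$; $A$ is called antisymmetric if $A^\tau=-A$. A basis projection is an orthogonal projection $P$ on $\mathcal K$ with $P+\overline P=\mathbf 1$. Fix a basis projection $P_1$, put $P_2=\mathbf 1-P_1=\overline{P_1}$, $\mathcal K_n=P_n(\mathcal K)$, and for $A\in\mathfrak B(\mathcal K)$ let $A_{mn}=P_mAP_n$, regarded as an operator from $\mathcal K_n$ to $\mathcal K_m$ ($m,n=1,2$). $\mathfrak P_{P_1}$ is the set of all basis projections $P$ of $\mathcal K$ such that $P_1-P$ is Hilbert–Schmidt. $\mathfrak H_{P_1}$ is the set of all antisymmetric Hilbert–Schmidt operators $T$ from $\mathcal K_1$ to $\mathcal K_2$ (i.e. $T^\tau=-T$), and $\tilde{\mathfrak P}_{P_1}$ is the set of all pairs $(T,\mathfrak h)$ with $T\in\mathfrak H_{P_1}$ and $\mathfrak h$ a finite-dimensional subspace of $\mathcal K_1$ with $\mathfrak h\subset\ker T$. *)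

theory Defs
  imports "HOL-Analysis.Analysis"
begin

section \<open>Complex Hilbert spaces\<close>

text \<open>The complex inner product is antilinear in its first argument.  The real inner product and the
  norm of the superclass are tied to it by \<open>inner x y = Re (cinner x y)\<close>, so that
  \<open>(norm x)\<^sup>2 = cinner x x\<close>, and positive definiteness is inherited.\<close>

class complex_inner = real_inner +
  fixes scaleC :: "complex \<Rightarrow> 'a \<Rightarrow> 'a" (infixr "*\<^sub>C" 75)
    and cinner :: "'a \<Rightarrow> 'a \<Rightarrow> complex"
  assumes scaleC_add_right: "c *\<^sub>C (x + y) = c *\<^sub>C x + c *\<^sub>C y"
    and scaleC_add_left: "(c + d) *\<^sub>C x = c *\<^sub>C x + d *\<^sub>C x"
    and scaleC_scaleC: "c *\<^sub>C (d *\<^sub>C x) = (c * d) *\<^sub>C x"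
    and scaleC_one: "1 *\<^sub>C x = x"
    and scaleR_scaleC: "r *\<^sub>R x = complex_of_real r *\<^sub>C x"
    and cinner_commute: "cinner x y = cnj (cinner y x)"
    and cinner_add_left: "cinner (x + y) z = cinner x z + cinner y z"
    and cinner_scaleC_left: "cinner (c *\<^sub>C x) y = cnj c * cinner x y"
    and inner_eq_Re_cinner: "inner x y = Re (cinner x y)"

class chilbert_space = complex_inner + complete_space

global_interpretation complex_vector: vector_space "scaleC :: complex \<Rightarrow> 'a \<Rightarrow> 'a::complex_inner"
  defines csubspace = complex_vector.subspace
    and cspan = complex_vector.span
  by unfold_locales (simp_all add: scaleC_add_right scaleC_add_left scaleC_scaleC scaleC_one)

definition finite_cdim :: "'a::complex_inner set \<Rightarrow> bool" where
  "finite_cdim S \<longleftrightarrow> (\<exists>B. finite B \<and> cspan B = S)"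

definition separable_type :: "'a::topological_space itself \<Rightarrow> bool" where
  "separable_type _ \<longleftrightarrow> (\<exists>D :: 'a set. countable D \<and> closure D = UNIV)"

definition is_onb :: "'a::complex_inner set \<Rightarrow> bool" where
  "is_onb E \<longleftrightarrow> (\<forall>e\<in>E. norm e = 1) \<and> (\<forall>e\<in>E. \<forall>e'\<in>E. e \<noteq> e' \<longrightarrow> cinner e e' = 0) \<and>
     closure (cspan E) = UNIV"

section \<open>Operators\<close>

definition bounded_clinear :: "('a::complex_inner \<Rightarrow> 'b::complex_inner) \<Rightarrow> bool" where
  "bounded_clinear A \<longleftrightarrow> bounded_linear A \<and> (\<forall>c x. A (c *\<^sub>C x) = c *\<^sub>C A x)"

definition cadjoint :: "('a::chilbert_space \<Rightarrow> 'a) \<Rightarrow> 'a \<Rightarrow> 'a" where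
  "cadjoint A = (THE B. \<forall>f g. cinner (A f) g = cinner f (B g))"

definition hilbert_schmidt :: "('a::chilbert_space \<Rightarrow> 'a) \<Rightarrow> bool" where
  "hilbert_schmidt A \<longleftrightarrow> bounded_clinear A \<and>
     (\<exists>E. is_onb E \<and> (\<lambda>e. (norm (A e))\<^sup>2) summable_on E)"

definition orth_projection :: "('a::chilbert_space \<Rightarrow> 'a) \<Rightarrow> bool" where
  "orth_projection P \<longleftrightarrow> bounded_clinear P \<and> P \<circ> P = P \<and> cadjoint P = P"

text \<open>The orthogonal projection onto a closed subspace \<open>S\<close>.\<close>

definition proj_onto :: "'a::chilbert_space set \<Rightarrow> 'a \<Rightarrow> 'a" where
  "proj_onto S f = (THE g. g \<in> S \<and> (\<forall>s\<in>S. cinner s (f - g) = 0))"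

section \<open>Conjugation and basis projections\<close>

definition conjugation :: "('a::chilbert_space \<Rightarrow> 'a) \<Rightarrow> bool" where
  "conjugation J \<longleftrightarrow> (\<forall>f g. J (f + g) = J f + J g) \<and> (\<forall>c f. J (c *\<^sub>C f) = cnj c *\<^sub>C J f) \<and>
     (\<forall>f g. cinner (J f) (J g) = cinner g f) \<and> (\<forall>f. J (J f) = f)"

definition conj_op :: "('a::chilbert_space \<Rightarrow> 'a) \<Rightarrow> ('a \<Rightarrow> 'a) \<Rightarrow> 'a \<Rightarrow> 'a" where
  "conj_op J A = (\<lambda>f. J (A (J f)))"

definition transpose_op :: "('a::chilbert_space \<Rightarrow> 'a) \<Rightarrow> ('a \<Rightarrow> 'a) \<Rightarrow> 'a \<Rightarrow> 'a" where
  "transpose_op J A = conj_op J (cadjoint A)"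

definition antisymmetric_op :: "('a::chilbert_space \<Rightarrow> 'a) \<Rightarrow> ('a \<Rightarrow> 'a) \<Rightarrow> bool" where
  "antisymmetric_op J A \<longleftrightarrow> transpose_op J A = (\<lambda>f. - A f)"

definition basis_projection :: "('a::chilbert_space \<Rightarrow> 'a) \<Rightarrow> ('a \<Rightarrow> 'a) \<Rightarrow> bool" where
  "basis_projection J P \<longleftrightarrow> orth_projection P \<and> (\<forall>f. P f + conj_op J P f = f)"

section \<open>Blocks with respect to a fixed basis projection\<close>

text \<open>Let \<open>Q\<close>, \<open>R\<close> be orthogonal projections.  An operator from \<open>range Q\<close> to \<open>range R\<close> is represented by
  its extension by zero to the whole space, i.e. by an operator \<open>A\<close> with \<open>A = R \<circ> A \<circ> Q\<close>.  Kernels are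
  then to be taken in \<open>range Q\<close>.  The extension does not affect adjoints, the transpose, or the
  Hilbert-Schmidt property.\<close>

definition block :: "('a \<Rightarrow> 'a) \<Rightarrow> ('a \<Rightarrow> 'a) \<Rightarrow> ('a \<Rightarrow> 'a) \<Rightarrow> 'a \<Rightarrow> 'a" where
  "block R A Q = R \<circ> A \<circ> Q"

definition compl_proj :: "('a::chilbert_space \<Rightarrow> 'a) \<Rightarrow> 'a \<Rightarrow> 'a" where
  "compl_proj P = (\<lambda>f. f - P f)"

definition ker_on :: "'a::chilbert_space set \<Rightarrow> ('a \<Rightarrow> 'a) \<Rightarrow> 'a set" where
  "ker_on S A = {f \<in> S. A f = 0}"

text \<open>For \<open>A\<close> acting on \<open>range Q\<close>, with \<open>range Q\<close> the direct sum of the range and the kernel of \<open>A\<close>: the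
  operator on \<open>range Q\<close> that inverts \<open>A\<close> as a map of its range to itself and vanishes on its kernel
  (extended by zero, as above).  A vector \<open>Q f\<close> is decomposed as \<open>A g + h\<close>, with \<open>g\<close> in the range and
  \<open>h\<close> in the kernel, and is mapped to \<open>g\<close>.\<close>

definition range_inverse :: "('a::chilbert_space \<Rightarrow> 'a) \<Rightarrow> ('a \<Rightarrow> 'a) \<Rightarrow> 'a \<Rightarrow> 'a" where
  "range_inverse Q A f =
     (THE g. g \<in> A ` range Q \<and> (\<exists>h \<in> ker_on (range Q) A. Q f = A g + h))"

text \<open>The set \<open>\<PP>\<^bsub>P1\<^esub>\<close>.\<close>

definition hs_basis_projections :: "('a::chilbert_space \<Rightarrow> 'a) \<Rightarrow> ('a \<Rightarrow> 'a) \<Rightarrow> ('a \<Rightarrow> 'a) set" where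
  "hs_basis_projections J P1 = {P. basis_projection J P \<and> hilbert_schmidt (\<lambda>f. P1 f - P f)}"

text \<open>The set \<open>\<HH>\<^bsub>P1\<^esub>\<close>.\<close>

definition hs_antisymmetric :: "('a::chilbert_space \<Rightarrow> 'a) \<Rightarrow> ('a \<Rightarrow> 'a) \<Rightarrow> ('a \<Rightarrow> 'a) set" where
  "hs_antisymmetric J P1 =
     {T. T = block (compl_proj P1) T P1 \<and> hilbert_schmidt T \<and> antisymmetric_op J T}"

text \<open>The set \<open>\<PP>\<^bsub>P1\<^esub>\<close> with a tilde.\<close>

definition hs_pairs ::
    "('a::chilbert_space \<Rightarrow> 'a) \<Rightarrow> ('a \<Rightarrow> 'a) \<Rightarrow> (('a \<Rightarrow> 'a) \<times> 'a set) set" where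
  "hs_pairs J P1 = {(T, h). T \<in> hs_antisymmetric J P1 \<and>
     csubspace h \<and> finite_cdim h \<and> h \<subseteq> ker_on (range P1) T}"

definition pair_of_proj :: "('a::chilbert_space \<Rightarrow> 'a) \<Rightarrow> ('a \<Rightarrow> 'a) \<Rightarrow> ('a \<Rightarrow> 'a) \<times> 'a set" where
  "pair_of_proj P1 P =
     (block (compl_proj P1) P P1 \<circ> range_inverse P1 (block P1 P P1),
      ker_on (range P1) (block P1 P P1))"

text \<open>\<open>P\<^sub>T\<close>: here \<open>P1 + T\<close> is an operator from \<open>range P1\<close> to the whole space.\<close>

definition graph_proj :: "('a::chilbert_space \<Rightarrow> 'a) \<Rightarrow> ('a \<Rightarrow> 'a) \<Rightarrow> 'a \<Rightarrow> 'a" where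
  "graph_proj P1 T = proj_onto ((\<lambda>f. P1 f + T f) ` range P1)"

definition proj_of_pair ::
    "('a::chilbert_space \<Rightarrow> 'a) \<Rightarrow> ('a \<Rightarrow> 'a) \<Rightarrow> ('a \<Rightarrow> 'a) \<times> 'a set \<Rightarrow> 'a \<Rightarrow> 'a" where
  "proj_of_pair J P1 = (\<lambda>(T, h) f.
     graph_proj P1 T f - proj_onto h f + conj_op J (proj_onto h) f)"

end

theory Submission
  imports Defs
begin

text \<open>A basis projection is the same thing as a closed subspace whose orthogonal complement is its
  conjugate, and the correspondence describes the range of \<open>P\<close> relative to the range of \<open>P1\<close>.  Write
  \<open>N = ker P\<^sub>1\<^sub>1\<close>, which equals \<open>ran P1 \<inter> ker P\<close>, let \<open>M\<close> be its orthogonal complement in \<open>ran P1\<close>, and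
  let \<open>T = P\<^sub>2\<^sub>1 P\<^sub>1\<^sub>1\<^sup>-\<^sup>1\<close>.  Then \<open>P g = P\<^sub>1\<^sub>1 g + T P\<^sub>1\<^sub>1 g\<close> for \<open>g \<in> M\<close>, and \<open>P\<^sub>1\<^sub>1\<close> maps \<open>M\<close> onto \<open>M\<close>, so
  \<open>P M\<close> is the graph of \<open>T\<close> over \<open>M\<close>.  The rest of \<open>ran P\<close> is \<open>ran P \<inter> ker P1 = J N\<close>.  Exchanging
  \<open>J N\<close> for \<open>N\<close> turns \<open>ran P\<close> into the whole graph of \<open>T\<close>, which is the formula
  \<open>P\<^sub>T = P + p\<^sub>N - p\<^bsub>J N\<^esub>\<close> (\<open>proj_of_pair_of_proj\<close>).

  Analytically, \<open>P1 - P\<close> being Hilbert-Schmidt has two effects.  The operator \<open>P1 - P\<close> is the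
  identity on \<open>N\<close>, which is therefore finite-dimensional, and it has norm at most \<open>1/2\<close> off finitely many directions, which
  makes \<open>P\<^sub>1\<^sub>1\<close> bounded below there.  Finitely many directions can be added back as long as the
  operator stays injective (\<open>bounded_below_if_bounded_below_off_finite\<close>), so \<open>P\<^sub>1\<^sub>1\<close> is bounded below
  on \<open>M\<close>; being self-adjoint it has closed range \<open>M\<close> and a bounded inverse there.

  Antisymmetry of \<open>T\<close> says that the graph of \<open>T\<close> is isotropic for the symmetric form
  \<open>\<langle>J u, v\<rangle>\<close>.  In one direction this holds because \<open>P M + N\<close> is isotropic (\<open>T_antisymmetric\<close>); in the
  other it shows that the orthogonal complement of the graph is exactly the conjugate of the graph
  (\<open>orthogonal_graph_iff_J\<close>), so that \<open>P\<^sub>T\<close> is a basis projection.  Applying \<open>1 + T\<^sup>*T\<close> to the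
  \<open>P1\<close>-component of \<open>P\<^sub>T x\<close> gives \<open>P1 x + T\<^sup>* x\<close> (\<open>normal_equation\<close>).  This yields the explicit formula
  for \<open>P\<^sub>T\<close> and expresses \<open>P\<^sub>T - P1\<close> through \<open>T\<close> and \<open>T\<^sup>*\<close>, whence it is Hilbert-Schmidt.\<close>

section \<open>Inner products, projections and adjoints\<close>

lemma cinner_add_right: "cinner x (y + z) = cinner x y + cinner x z"
  by (metis cinner_add_left cinner_commute complex_cnj_add)

lemma cinner_scaleC_right: "cinner x (c *\<^sub>C y) = c * cinner x y"
  by (metis cinner_commute cinner_scaleC_left complex_cnj_cnj complex_cnj_mult)

lemma cinner_zero_left [simp]: "cinner 0 y = 0"
  using cinner_add_left[of 0 0 y] by simp

lemma cinner_zero_right [simp]: "cinner x 0 = 0"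
  using cinner_add_right[of x 0 0] by simp

lemma cinner_minus_left: "cinner (- x) y = - cinner x y"
  using cinner_add_left[of x "- x" y] by (simp add: eq_neg_iff_add_eq_0 add.commute)

lemma cinner_minus_right: "cinner x (- y) = - cinner x y"
  using cinner_add_right[of x y "- y"] by (simp add: eq_neg_iff_add_eq_0 add.commute)

lemma cinner_diff_left: "cinner (x - y) z = cinner x z - cinner y z"
  using cinner_add_left[of x "- y" z] by (simp add: cinner_minus_left)

lemma cinner_diff_right: "cinner x (y - z) = cinner x y - cinner x z"
  using cinner_add_right[of x y "- z"] by (simp add: cinner_minus_right)

lemma cinner_sum_right: "cinner x (\<Sum>i\<in>I. f i) = (\<Sum>i\<in>I. cinner x (f i))"
  by (induction I rule: infinite_finite_induct) (simp_all add: cinner_add_right)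

lemma cinner_sum_left: "cinner (\<Sum>i\<in>I. f i) x = (\<Sum>i\<in>I. cinner (f i) x)"
  by (induction I rule: infinite_finite_induct) (simp_all add: cinner_add_left)

lemmas cinner_simps = cinner_add_left cinner_add_right cinner_diff_left cinner_diff_right
  cinner_scaleC_left cinner_scaleC_right cinner_minus_left cinner_minus_right

lemma cinner_eq_0_commute: "cinner x y = 0 \<longleftrightarrow> cinner y x = 0"
  by (metis cinner_commute complex_cnj_zero)

lemma cmod_cinner_commute: "cmod (cinner x y) = cmod (cinner y x)"
  by (metis cinner_commute complex_mod_cnj)

lemma cinner_self: "cinner x x = complex_of_real ((norm x)\<^sup>2)"
proof (rule complex_eqI)
  show "Re (cinner x x) = Re (complex_of_real ((norm x)\<^sup>2))"
    by (simp add: inner_eq_Re_cinner[symmetric] power2_norm_eq_inner)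
  have "Im (cinner x x) = - Im (cinner x x)"
    by (subst cinner_commute) simp
  then show "Im (cinner x x) = Im (complex_of_real ((norm x)\<^sup>2))" by simp
qed

lemma cinner_self_eq_0_iff [simp]: "cinner x x = 0 \<longleftrightarrow> x = 0"
  by (simp add: cinner_self)

lemma cinner_eq_imp_eq: "(\<And>y. cinner y x = cinner y x') \<Longrightarrow> x = x'"
  by (metis cinner_diff_right cinner_self_eq_0_iff eq_iff_diff_eq_0)

lemma norm_scaleC: "norm (c *\<^sub>C x) = cmod c * norm (x::'a::complex_inner)"
proof -
  have "complex_of_real ((norm (c *\<^sub>C x))\<^sup>2) = (c * cnj c) * complex_of_real ((norm x)\<^sup>2)"
    unfolding cinner_self[symmetric] by (simp add: cinner_simps)
  also have "\<dots> = complex_of_real ((cmod c * norm x)\<^sup>2)"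
    by (simp add: complex_norm_square[symmetric] power_mult_distrib)
  finally have "(norm (c *\<^sub>C x))\<^sup>2 = (cmod c * norm x)\<^sup>2"
    by (simp only: of_real_eq_iff)
  then show ?thesis by simp
qed

lemma norm_cinner_le: "cmod (cinner x y) \<le> norm x * norm y"
proof (cases "cinner x y = 0")
  case False
  \<comment> \<open>This phase makes the inner product real, so the real Cauchy-Schwarz inequality applies.\<close>
  define c where "c = cnj (sgn (cinner x y))"
  have "cmod c = 1" using False by (simp add: c_def norm_sgn)
  have "c * cinner x y = complex_of_real (cmod (cinner x y))"
    unfolding c_def using False
    by (simp add: sgn_div_norm scaleR_conv_of_real field_simps complex_norm_square[symmetric] power2_eq_square)
  then have "cmod (cinner x y) = inner x (c *\<^sub>C y)"
    by (simp add: inner_eq_Re_cinner cinner_scaleC_right)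
  also have "\<dots> \<le> norm x * norm (c *\<^sub>C y)" by (rule norm_cauchy_schwarz)
  finally show ?thesis by (simp add: norm_scaleC \<open>cmod c = 1\<close>)
qed simp

lemma norm_add_orthogonal:
  "cinner x y = 0 \<Longrightarrow> (norm (x + y))\<^sup>2 = (norm x)\<^sup>2 + (norm y)\<^sup>2"
  using cinner_eq_0_commute[of x y]
  by (simp add: power2_norm_eq_inner inner_eq_Re_cinner cinner_simps)

lemma bounded_linear_cinner_right: "bounded_linear (cinner x)"
  by (rule bounded_linear_intro[where K="norm x"])
    (auto simp: cinner_simps scaleR_scaleC scaleR_conv_of_real norm_cinner_le
      intro: order_trans[OF norm_cinner_le])

lemma closed_orthogonal: "closed {f. \<forall>s\<in>S. cinner s f = 0}"
proof -
  have "closed (\<Inter>s\<in>S. {f. cinner s f = 0})"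
    by (intro closed_INT ballI closed_Collect_eq linear_continuous_on
        bounded_linear_cinner_right continuous_on_const)
  moreover have "(\<Inter>s\<in>S. {f. cinner s f = 0}) = {f. \<forall>s\<in>S. cinner s f = 0}" by auto
  ultimately show ?thesis by simp
qed

lemma csubspace_orthogonal: "csubspace {f. \<forall>s\<in>S. cinner s f = 0}"
  by (rule complex_vector.subspaceI) (auto simp: cinner_simps)

lemma bounded_clinearI:
  assumes "\<And>x y. A (x + y) = A x + A y" "\<And>c x. A (c *\<^sub>C x) = c *\<^sub>C A x"
    and "\<And>x. norm (A x) \<le> norm x * K"
  shows "bounded_clinear A"
  unfolding bounded_clinear_def
  using assms by (auto intro!: bounded_linear_intro[where K=K] simp: scaleR_scaleC)

lemma
  assumes "bounded_clinear A"
  shows bounded_clinear_add: "A (x + y) = A x + A y"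
    and bounded_clinear_diff: "A (x - y) = A x - A y"
    and bounded_clinear_zero: "A 0 = 0"
    and bounded_clinear_scaleC: "A (c *\<^sub>C x) = c *\<^sub>C A x"
    and bounded_clinear_bound: "\<exists>K>0. \<forall>x. norm (A x) \<le> norm x * K"
    and bounded_clinear_bounded_linear: "bounded_linear A"
  using assms bounded_linear.pos_bounded[of A]
  by (auto simp: bounded_clinear_def linear_simps)

lemma bounded_clinear_compose:
  "bounded_clinear A \<Longrightarrow> bounded_clinear B \<Longrightarrow> bounded_clinear (\<lambda>x. A (B x))"
  by (simp add: bounded_clinear_def bounded_linear_compose)

lemma bounded_clinear_sum:
  "bounded_clinear A \<Longrightarrow> bounded_clinear B \<Longrightarrow> bounded_clinear (\<lambda>x. A x + B x)"
  by (simp add: bounded_clinear_def bounded_linear_add scaleC_add_right)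

lemma bounded_clinear_sub:
  "bounded_clinear A \<Longrightarrow> bounded_clinear B \<Longrightarrow> bounded_clinear (\<lambda>x. A x - B x)"
  by (simp add: bounded_clinear_def bounded_linear_sub complex_vector.scale_right_diff_distrib)

lemma bounded_clinear_ident: "bounded_clinear (\<lambda>x. x)"
  by (simp add: bounded_clinear_def bounded_linear_ident)

lemma csubspace_image:
  assumes "bounded_clinear A" "csubspace S"
  shows "csubspace (A ` S)"
proof (rule complex_vector.subspaceI)
  show "0 \<in> A ` S"
    using complex_vector.subspace_0[OF assms(2)] bounded_clinear_zero[OF assms(1)] by force
  show "x + y \<in> A ` S" if "x \<in> A ` S" "y \<in> A ` S" for x y
    using that complex_vector.subspace_add[OF assms(2)]
    by (auto simp: bounded_clinear_add[OF assms(1), symmetric])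
  show "c *\<^sub>C x \<in> A ` S" if "x \<in> A ` S" for c x
    using that complex_vector.subspace_scale[OF assms(2)]
    by (auto simp: bounded_clinear_scaleC[OF assms(1), symmetric])
qed

text \<open>The projection theorem, by completeness: by the parallelogram law the sets of near-minimisers
  of the distance shrink to a point, and a minimiser is orthogonal to the subspace because
  otherwise a step along a non-orthogonal direction would decrease the distance.\<close>

lemma projection_exists:
  fixes S :: "'a::chilbert_space set"
  assumes S: "csubspace S" "closed S"
  shows "\<exists>p\<in>S. \<forall>s\<in>S. cinner s (x - p) = 0"
proof -
  define d where "d = infdist x S"
  have ne: "S \<noteq> {}" using complex_vector.subspace_0[OF S(1)] by auto
  have d0: "d \<ge> 0" by (simp add: d_def infdist_nonneg)
  have d_le: "d\<^sup>2 \<le> (norm (x - s))\<^sup>2" if "s \<in> S" for s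
    using infdist_le[OF that, of x] d0 by (simp add: d_def dist_norm power_mono)
  define N where "N n = {s\<in>S. (norm (x - s))\<^sup>2 \<le> d\<^sup>2 + 1 / real (Suc n)}" for n
  have midpoint: "(1/2) *\<^sub>R (s + t) \<in> S" if "s \<in> S" "t \<in> S" for s t
    using that S(1)
    by (simp add: scaleR_scaleC complex_vector.subspace_add complex_vector.subspace_scale)
  have close: "(norm (s - t))\<^sup>2 \<le> 4 / real (Suc n)" if "s \<in> N n" "t \<in> N n" for s t n
  proof -
    have eq: "(norm (s - t))\<^sup>2
        = 2 * (norm (x - s))\<^sup>2 + 2 * (norm (x - t))\<^sup>2 - 4 * (norm (x - (1/2) *\<^sub>R (s + t)))\<^sup>2"
      by (simp add: power2_norm_eq_inner inner_simps inner_commute algebra_simps)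
    have "d\<^sup>2 \<le> (norm (x - (1/2) *\<^sub>R (s + t)))\<^sup>2"
      using that by (intro d_le midpoint) (auto simp: N_def)
    moreover have "(norm (x - s))\<^sup>2 \<le> d\<^sup>2 + 1 / real (Suc n)" "(norm (x - t))\<^sup>2 \<le> d\<^sup>2 + 1 / real (Suc n)"
      using that by (auto simp: N_def)
    ultimately show ?thesis using eq by simp
  qed
  have "\<exists>a. \<Inter>(range N) = {a}"
  proof (rule decreasing_closed_nest_sing)
    show "closed (N n)" for n
    proof -
      have "N n = S \<inter> {s. (norm (x - s))\<^sup>2 \<le> d\<^sup>2 + 1 / real (Suc n)}" by (auto simp: N_def)
      also have "closed \<dots>"
        by (intro closed_Int S(2) closed_Collect_le continuous_intros)
      finally show ?thesis .
    qed
    show "N n \<noteq> {}" for n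
    proof -
      have "d < sqrt (d\<^sup>2 + 1 / real (Suc n))"
        by (rule real_less_rsqrt) simp
      then obtain s where s: "s \<in> S" "dist x s < sqrt (d\<^sup>2 + 1 / real (Suc n))"
        using ne unfolding d_def infdist_notempty[OF ne]
        by (subst (asm) cInf_less_iff) (auto intro: bdd_belowI2[where m=0])
      then have "(dist x s)\<^sup>2 \<le> d\<^sup>2 + 1 / real (Suc n)"
        using power_mono[of "dist x s" "sqrt (d\<^sup>2 + 1 / real (Suc n))" 2] by simp
      then show ?thesis using s by (auto simp: N_def dist_norm)
    qed
    show "N n \<subseteq> N m" if "m \<le> n" for m n
    proof -
      have "1 / real (Suc n) \<le> 1 / real (Suc m)" using that by (simp add: field_simps)
      then show ?thesis by (auto simp: N_def)
    qed
    show "\<exists>n. \<forall>s\<in>N n. \<forall>t\<in>N n. dist s t < e" if "e > 0" for e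
    proof -
      have "e\<^sup>2 / 4 > 0" using that by simp
      then obtain n where n: "inverse (real (Suc n)) < e\<^sup>2 / 4"
        using reals_Archimedean by blast
      have "dist s t < e" if st: "s \<in> N n" "t \<in> N n" for s t
      proof (rule power2_less_imp_less)
        show "(dist s t)\<^sup>2 < e\<^sup>2" using close[OF st] n unfolding dist_norm divide_inverse[of 4] by linarith
      qed (use \<open>e > 0\<close> in simp)
      then show ?thesis by blast
    qed
  qed
  then obtain p where p: "\<And>n. p \<in> N n" by blast
  then have pS: "p \<in> S" by (auto simp: N_def)
  have min: "(norm (x - p))\<^sup>2 \<le> d\<^sup>2"
  proof (rule field_le_epsilon)
    fix e :: real assume "e > 0"
    then obtain n where "inverse (real (Suc n)) < e" using reals_Archimedean by blast
    then show "(norm (x - p))\<^sup>2 \<le> d\<^sup>2 + e"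
      using p[of n] by (auto simp: N_def inverse_eq_divide)
  qed
  have "cinner s (x - p) = 0" if s: "s \<in> S" for s
  proof (rule ccontr)
    assume nz: "cinner s (x - p) \<noteq> 0"
    then have s0: "s \<noteq> 0" by auto
    \<comment> \<open>The step from \<open>p\<close> along \<open>s\<close> to the foot of the perpendicular from \<open>x\<close>.\<close>
    define c where "c = cinner s (x - p) / complex_of_real ((norm s)\<^sup>2)"
    have orth: "cinner (x - p - c *\<^sub>C s) (c *\<^sub>C s) = 0"
    proof -
      have "cinner s (x - p - c *\<^sub>C s) = 0"
        using s0 by (simp add: cinner_diff_right[of s "x - p"] cinner_scaleC_right c_def cinner_self)
      then show ?thesis
        by (simp add: cinner_scaleC_right cinner_eq_0_commute[of "x - p - c *\<^sub>C s"])
    qed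
    have "(norm (x - p))\<^sup>2 = (norm (x - p - c *\<^sub>C s))\<^sup>2 + (norm (c *\<^sub>C s))\<^sup>2"
      using norm_add_orthogonal[OF orth] by simp
    moreover have "d\<^sup>2 \<le> (norm (x - (p + c *\<^sub>C s)))\<^sup>2"
      using S(1) pS s
      by (intro d_le complex_vector.subspace_add complex_vector.subspace_scale)
    moreover have "(norm (c *\<^sub>C s))\<^sup>2 > 0"
      using nz s0 by (simp add: c_def)
    ultimately show False using min by (simp add: diff_diff_eq)
  qed
  with pS show ?thesis by blast
qed

lemma proj_onto_unique:
  assumes "csubspace S" "p \<in> S" "\<forall>s\<in>S. cinner s (x - p) = 0" "q \<in> S" "\<forall>s\<in>S. cinner s (x - q) = 0"
  shows "p = q"
proof -
  have "p - q \<in> S" using assms complex_vector.subspace_diff by blast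
  then have "cinner (p - q) (x - q) - cinner (p - q) (x - p) = 0" using assms by simp
  then show ?thesis by (simp add: cinner_diff_right[symmetric])
qed

lemma proj_onto_eqI:
  assumes "csubspace S" "p \<in> S" "\<And>s. s \<in> S \<Longrightarrow> cinner s (x - p) = 0"
  shows "proj_onto S x = p"
  unfolding proj_onto_def
  by (rule the_equality) (use assms proj_onto_unique[OF assms(1)] in blast)+

lemma
  fixes S :: "'a::chilbert_space set"
  assumes S: "csubspace S" "closed S"
  shows proj_onto_mem: "proj_onto S x \<in> S"
    and proj_onto_orth: "s \<in> S \<Longrightarrow> cinner s (x - proj_onto S x) = 0"
  using projection_exists[OF S, of x] proj_onto_eqI[OF S(1), of _ x] by auto

text \<open>Riesz representation: the representing vector spans the orthogonal complement of the kernel.\<close>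

lemma riesz:
  fixes \<phi> :: "'a::chilbert_space \<Rightarrow> complex"
  assumes add: "\<And>x y. \<phi> (x + y) = \<phi> x + \<phi> y" and scale: "\<And>c x. \<phi> (c *\<^sub>C x) = c * \<phi> x"
    and bound: "\<And>x. cmod (\<phi> x) \<le> norm x * K"
  shows "\<exists>z. \<forall>x. \<phi> x = cinner z x"
proof (cases "\<forall>x. \<phi> x = 0")
  case True
  then show ?thesis by (intro exI[of _ 0]) simp
next
  case False
  then obtain a where a: "\<phi> a \<noteq> 0" by blast
  have blin: "bounded_linear \<phi>"
    by (rule bounded_linear_intro[where K=K])
      (auto simp: add scale bound scaleR_scaleC scaleR_conv_of_real)
  define M where "M = {x. \<phi> x = 0}"
  have "\<phi> 0 = 0" using blin by (simp add: linear_simps)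
  then have subM: "csubspace M"
    by (intro complex_vector.subspaceI) (auto simp: M_def add scale)
  have "closed M"
    unfolding M_def
    by (intro closed_Collect_eq linear_continuous_on blin continuous_on_const)
  define w where "w = a - proj_onto M a"
  have w: "\<phi> w = \<phi> a"
    using proj_onto_mem[OF subM \<open>closed M\<close>, of a] blin by (simp add: w_def M_def linear_simps)
  then have w0: "w \<noteq> 0" using a \<open>\<phi> 0 = 0\<close> by auto
  have "\<phi> x = cinner (cnj (\<phi> w / complex_of_real ((norm w)\<^sup>2)) *\<^sub>C w) x" for x
  proof -
    have "x - (\<phi> x / \<phi> w) *\<^sub>C w \<in> M"
      using a blin w by (simp add: M_def linear_simps scale)
    then have "cinner (x - (\<phi> x / \<phi> w) *\<^sub>C w) w = 0"
      using proj_onto_orth[OF subM \<open>closed M\<close>] by (simp add: w_def)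
    then have "cinner w (x - (\<phi> x / \<phi> w) *\<^sub>C w) = 0" by (simp add: cinner_eq_0_commute)
    then show ?thesis
      using a w w0 by (simp add: cinner_simps cinner_self field_simps)
  qed
  then show ?thesis by blast
qed

lemma cadjoint_eqI:
  assumes "\<And>f g. cinner (A f) g = cinner f (B g)"
  shows "cadjoint A = B"
  unfolding cadjoint_def
proof (rule the_equality)
  show "C = B" if "\<forall>f g. cinner (A f) g = cinner f (C g)" for C
    using that assms by (intro ext cinner_eq_imp_eq) simp
qed (use assms in blast)

lemma cinner_cadjoint:
  assumes A: "bounded_clinear A"
  shows "cinner (A f) g = cinner f (cadjoint A g)"
proof -
  obtain K where K: "\<And>x. norm (A x) \<le> norm x * K" using bounded_clinear_bound[OF A] by blast
  have "\<exists>z. \<forall>x. cinner g (A x) = cinner z x" for g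
  proof (rule riesz[where K = "K * norm g"])
    show "cmod (cinner g (A x)) \<le> norm x * (K * norm g)" for x
      using norm_cinner_le[of g "A x"] mult_left_mono[OF K[of x], of "norm g"]
      by (simp add: mult_ac)
  qed (simp_all add: bounded_clinear_add[OF A] bounded_clinear_scaleC[OF A] cinner_simps)
  then obtain B where "\<And>g x. cinner g (A x) = cinner (B g) x" by metis
  then have "cinner (A f) g = cinner f (B g)" for f g by (metis cinner_commute)
  then show ?thesis using cadjoint_eqI by metis
qed

lemma cinner_cadjoint_right:
  "bounded_clinear A \<Longrightarrow> cinner f (A g) = cinner (cadjoint A f) g"
  by (metis cinner_cadjoint cinner_commute)

lemma bounded_clinear_cadjoint:
  assumes A: "bounded_clinear A"
  shows "bounded_clinear (cadjoint A)"
proof -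
  obtain K where K: "K > 0" "\<And>x. norm (A x) \<le> norm x * K"
    using bounded_clinear_bound[OF A] by blast
  show ?thesis
  proof (rule bounded_clinearI[where K = K])
    fix x y c
    show "cadjoint A (x + y) = cadjoint A x + cadjoint A y"
      by (rule cinner_eq_imp_eq) (simp add: cinner_simps cinner_cadjoint[OF A, symmetric])
    show "cadjoint A (c *\<^sub>C x) = c *\<^sub>C cadjoint A x"
      by (rule cinner_eq_imp_eq) (simp add: cinner_simps cinner_cadjoint[OF A, symmetric])
    let ?y = "cadjoint A x"
    have "(norm ?y)\<^sup>2 = cmod (cinner (A ?y) x)"
      by (simp add: cinner_cadjoint[OF A] cinner_self norm_power)
    also have "\<dots> \<le> norm ?y * K * norm x"
      using norm_cinner_le[of "A ?y" x] mult_right_mono[OF K(2)[of ?y], of "norm x"] by simp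
    finally have "norm ?y * norm ?y \<le> norm ?y * (norm x * K)"
      by (simp add: power2_eq_square mult_ac)
    then show "norm ?y \<le> norm x * K"
      using K(1) by (cases "?y = 0") auto
  qed
qed

lemma cadjoint_cadjoint: "bounded_clinear A \<Longrightarrow> cadjoint (cadjoint A) = A"
  by (rule cadjoint_eqI) (simp add: cinner_cadjoint_right)

lemma orth_projection_iff:
  "orth_projection P \<longleftrightarrow>
     bounded_clinear P \<and> (\<forall>f. P (P f) = P f) \<and> (\<forall>f g. cinner (P f) g = cinner f (P g))"
  using cinner_cadjoint[of P] cadjoint_eqI[of P P]
  by (auto simp: orth_projection_def fun_eq_iff)

lemma
  assumes "orth_projection P"
  shows orth_projection_bounded: "bounded_clinear P"
    and orth_projection_idem: "P (P f) = P f"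
    and orth_projection_sym: "cinner (P f) g = cinner f (P g)"
  using assms by (auto simp: orth_projection_iff)

lemma mem_range_projection: "orth_projection P \<Longrightarrow> f \<in> range P \<longleftrightarrow> P f = f"
  by (metis orth_projection_idem rangeE rangeI)

lemma norm_projection_power2:
  assumes "orth_projection P"
  shows "complex_of_real ((norm (P f))\<^sup>2) = cinner f (P f)"
  by (simp only: cinner_self[symmetric] orth_projection_sym[OF assms] orth_projection_idem[OF assms])

lemma csubspace_range_projection: "orth_projection P \<Longrightarrow> csubspace (range P)"
  by (intro csubspace_image complex_vector.subspace_UNIV orth_projection_bounded)

lemma closed_range_projection:
  assumes "orth_projection P"
  shows "closed (range P)"
proof -
  have "range P = {f. P f = f}" using mem_range_projection[OF assms] by blast
  also have "closed \<dots>"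
    by (intro closed_Collect_eq linear_continuous_on continuous_on_id
        bounded_clinear_bounded_linear orth_projection_bounded assms)
  finally show ?thesis .
qed

lemma norm_projection_le:
  assumes "orth_projection P"
  shows "norm (P f) \<le> norm f"
proof -
  have "(norm (P f))\<^sup>2 \<le> norm f * norm (P f)"
    using norm_cinner_le[of f "P f"]
    by (metis assms norm_of_real norm_projection_power2 abs_power2)
  then show ?thesis by (cases "P f = 0") (auto simp: power2_eq_square)
qed

lemma orth_projection_proj_onto:
  fixes S :: "'a::chilbert_space set"
  assumes S: "csubspace S" "closed S"
  shows "orth_projection (proj_onto S)"
proof -
  let ?p = "proj_onto S"
  note mem = proj_onto_mem[OF S] and orth = proj_onto_orth[OF S]
  have add: "?p (x + y) = ?p x + ?p y" for x y
    using mem orth[of _ x] orth[of _ y] S(1)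
    by (intro proj_onto_eqI) (auto simp: cinner_simps algebra_simps complex_vector.subspace_add)
  have scale: "?p (c *\<^sub>C x) = c *\<^sub>C ?p x" for c x
    using mem orth[of _ x] S(1)
    by (intro proj_onto_eqI) (auto simp: cinner_simps complex_vector.subspace_scale)
  have bound: "norm (?p x) \<le> norm x * 1" for x
  proof -
    have "(norm x)\<^sup>2 = (norm (?p x))\<^sup>2 + (norm (x - ?p x))\<^sup>2"
      using norm_add_orthogonal[OF orth[OF mem], of x x] by simp
    then have "(norm (?p x))\<^sup>2 \<le> (norm x)\<^sup>2" by simp
    then show ?thesis by simp
  qed
  have sym: "cinner (?p f) g = cinner f (?p g)" for f g
  proof -
    have "cinner (?p f) (g - ?p g) = 0" by (rule orth[OF mem])
    moreover have "cinner (f - ?p f) (?p g) = 0"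
      using orth[OF mem] by (simp add: cinner_eq_0_commute)
    ultimately show ?thesis by (simp add: cinner_simps)
  qed
  show ?thesis
    unfolding orth_projection_iff
    using bounded_clinearI[of ?p, OF add scale bound] sym mem S(1)
    by (auto intro!: proj_onto_eqI)
qed

lemma range_proj_onto:
  fixes S :: "'a::chilbert_space set"
  assumes S: "csubspace S" "closed S"
  shows "range (proj_onto S) = S"
proof
  show "S \<subseteq> range (proj_onto S)"
    using proj_onto_eqI[OF S(1)] by (metis cinner_zero_right diff_self rangeI subsetI)
qed (use proj_onto_mem[OF S] in blast)

section \<open>Orthonormal sets and finite-dimensional subspaces\<close>

definition orthonormal :: "'a::complex_inner set \<Rightarrow> bool" where
  "orthonormal F \<longleftrightarrow> (\<forall>e\<in>F. norm e = 1) \<and> (\<forall>e\<in>F. \<forall>e'\<in>F. e \<noteq> e' \<longrightarrow> cinner e e' = 0)"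

definition fourier_sum :: "'a::complex_inner set \<Rightarrow> 'a \<Rightarrow> 'a" where
  "fourier_sum F x = (\<Sum>e\<in>F. cinner e x *\<^sub>C e)"

lemma orthonormal_subset: "orthonormal E \<Longrightarrow> F \<subseteq> E \<Longrightarrow> orthonormal F"
  by (auto simp: orthonormal_def)

lemma orthonormal_insert:
  assumes "orthonormal F" "norm e = 1" "\<And>f. f \<in> F \<Longrightarrow> cinner f e = 0"
  shows "orthonormal (insert e F)"
  using assms cinner_eq_0_commute[of e] by (auto simp: orthonormal_def)

lemma fourier_sum_in_cspan: "fourier_sum F x \<in> cspan F"
  unfolding fourier_sum_def
  by (intro complex_vector.span_sum complex_vector.span_scale complex_vector.span_base)

lemma cinner_fourier_sum:
  assumes "finite F" "orthonormal F" "e \<in> F"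
  shows "cinner e (fourier_sum F x) = cinner e x"
proof -
  have "cinner e (fourier_sum F x) = (\<Sum>f\<in>F. if f = e then cinner e x else 0)"
    unfolding fourier_sum_def cinner_sum_right
    using assms by (intro sum.cong) (auto simp: cinner_scaleC_right cinner_self orthonormal_def)
  then show ?thesis using assms by simp
qed

lemma fourier_sum_residual_orth:
  assumes "finite F" "orthonormal F" "s \<in> cspan F"
  shows "cinner s (x - fourier_sum F x) = 0"
proof -
  have "csubspace {s. cinner s (x - fourier_sum F x) = 0}"
    by (rule complex_vector.subspaceI) (auto simp: cinner_simps)
  moreover have "F \<subseteq> {s. cinner s (x - fourier_sum F x) = 0}"
    using cinner_fourier_sum[OF assms(1,2)] by (auto simp: cinner_diff_right)
  ultimately show ?thesis
    using complex_vector.span_minimal assms(3) by blast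
qed

lemma norm_fourier_sum:
  assumes "finite F" "orthonormal F"
  shows "(norm (fourier_sum F x))\<^sup>2 = (\<Sum>e\<in>F. (cmod (cinner e x))\<^sup>2)"
proof -
  have "complex_of_real ((norm (fourier_sum F x))\<^sup>2)
      = (\<Sum>e\<in>F. cnj (cinner e x) * cinner e (fourier_sum F x))"
    unfolding cinner_self[symmetric] by (subst fourier_sum_def)
      (simp add: cinner_sum_left cinner_scaleC_left)
  also have "\<dots> = (\<Sum>e\<in>F. complex_of_real ((cmod (cinner e x))\<^sup>2))"
    using cinner_fourier_sum[OF assms]
    by (intro sum.cong) (simp_all add: complex_norm_square[symmetric] mult.commute)
  finally show ?thesis by (simp only: of_real_sum[symmetric] of_real_eq_iff)
qed

lemma pythagoras_fourier_sum:
  assumes "finite F" "orthonormal F"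
  shows "(norm x)\<^sup>2 = (norm (x - fourier_sum F x))\<^sup>2 + (\<Sum>e\<in>F. (cmod (cinner e x))\<^sup>2)"
  using norm_add_orthogonal[OF fourier_sum_residual_orth[OF assms fourier_sum_in_cspan], of x x]
  by (simp add: norm_fourier_sum[OF assms])

lemma bessel:
  assumes "finite F" "orthonormal F"
  shows "(\<Sum>e\<in>F. (cmod (cinner e x))\<^sup>2) \<le> (norm x)\<^sup>2"
  using pythagoras_fourier_sum[OF assms, of x] by simp

lemma bounded_clinear_fourier_sum:
  assumes "finite F" "orthonormal F"
  shows "bounded_clinear (fourier_sum F)"
proof (rule bounded_clinearI[where K = 1])
  fix x y c
  show "fourier_sum F (x + y) = fourier_sum F x + fourier_sum F y"
    by (simp add: fourier_sum_def cinner_add_right scaleC_add_left sum.distrib)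
  show "fourier_sum F (c *\<^sub>C x) = c *\<^sub>C fourier_sum F x"
    by (simp add: fourier_sum_def cinner_scaleC_right complex_vector.scale_sum_right scaleC_scaleC)
  have "(norm (fourier_sum F x))\<^sup>2 \<le> (norm x)\<^sup>2"
    using bessel[OF assms] by (simp add: norm_fourier_sum[OF assms])
  then show "norm (fourier_sum F x) \<le> norm x * 1" by simp
qed

lemma fourier_sum_eq_self:
  assumes "finite F" "orthonormal F" "x \<in> cspan F"
  shows "fourier_sum F x = x"
proof -
  have "x - fourier_sum F x \<in> cspan F"
    using assms(3) fourier_sum_in_cspan by (rule complex_vector.span_diff)
  then have "cinner (x - fourier_sum F x) (x - fourier_sum F x) = 0"
    by (rule fourier_sum_residual_orth[OF assms(1,2)])
  then show ?thesis by simp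
qed

lemma closed_cspan_orthonormal:
  fixes F :: "'a::complex_inner set"
  assumes "finite F" "orthonormal F"
  shows "closed (cspan F)"
proof -
  have "cspan F = {x. fourier_sum F x = x}"
    using fourier_sum_eq_self[OF assms] fourier_sum_in_cspan[of F] by (metis (mono_tags) Collect_cong Collect_mem_eq)
  also have "closed \<dots>"
    by (intro closed_Collect_eq linear_continuous_on continuous_on_id
        bounded_clinear_bounded_linear bounded_clinear_fourier_sum assms)
  finally show ?thesis .
qed

lemma gram_schmidt_step:
  assumes "finite F" "orthonormal F" "x \<notin> cspan F"
  obtains e where "orthonormal (insert e F)" "e \<notin> F" "e \<in> cspan (insert x F)" "x \<in> cspan (insert e F)"
proof -
  define w where "w = x - fourier_sum F x"
  have w0: "w \<noteq> 0" using assms(3) fourier_sum_in_cspan[of F x] by (auto simp: w_def)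
  define e where "e = complex_of_real (inverse (norm w)) *\<^sub>C w"
  have orth: "cinner f w = 0" if "f \<in> cspan F" for f
    unfolding w_def using assms(1,2) that by (rule fourier_sum_residual_orth)
  have ne: "norm e = 1" using w0 by (simp add: e_def norm_scaleC norm_inverse)
  have oe: "cinner f e = 0" if "f \<in> F" for f
    using orth[OF complex_vector.span_base[OF that]] by (simp add: e_def cinner_scaleC_right)
  show ?thesis
  proof
    show "orthonormal (insert e F)" using assms(2) ne oe by (rule orthonormal_insert)
    show "e \<notin> F" using ne oe by force
    have four: "fourier_sum F x \<in> cspan (insert y F)" for y
      using fourier_sum_in_cspan complex_vector.span_mono[OF subset_insertI] by blast
    show "e \<in> cspan (insert x F)"
      unfolding e_def w_def
      by (intro complex_vector.span_scale complex_vector.span_diff four complex_vector.span_base) simp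
    have "x = complex_of_real (norm w) *\<^sub>C e + fourier_sum F x"
      using w0 by (simp add: e_def scaleC_scaleC scaleC_one w_def[symmetric] flip: of_real_mult)
         (simp add: w_def)
    also have "\<dots> \<in> cspan (insert e F)"
      by (intro complex_vector.span_scale complex_vector.span_add four complex_vector.span_base) simp
    finally show "x \<in> cspan (insert e F)" .
  qed
qed

lemma gram_schmidt:
  assumes "finite B"
  shows "\<exists>F. finite F \<and> orthonormal F \<and> cspan F = cspan B"
  using assms
proof (induction B rule: finite_induct)
  case empty
  show ?case by (intro exI[of _ "{}"]) (simp add: orthonormal_def)
next
  case (insert b B)
  then obtain F where F: "finite F" "orthonormal F" "cspan F = cspan B" by blast
  show ?case
  proof (cases "b \<in> cspan F")
    case True
    then have "cspan (insert b B) = cspan F"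
      using F(3) complex_vector.span_redundant by metis
    then show ?thesis using F by blast
  next
    case False
    then obtain e where e: "orthonormal (insert e F)" "e \<in> cspan (insert b F)" "b \<in> cspan (insert e F)"
      using gram_schmidt_step[OF F(1,2)] by blast
    have mono: "cspan F \<subseteq> cspan (insert y F)" "cspan B \<subseteq> cspan (insert y B)" for y
      by (intro complex_vector.span_mono subset_insertI)+
    have "cspan (insert b F) \<subseteq> cspan (insert b B)"
      using mono(2)[of b] complex_vector.span_superset[of F] complex_vector.span_superset[of "insert b B"] F(3)
      by (intro complex_vector.span_minimal) auto
    then have "cspan (insert e F) = cspan (insert b B)"
      unfolding complex_vector.span_eq
      using e(2,3) mono[of e] mono[of b] complex_vector.span_superset[of F]
        complex_vector.span_superset[of B] F(3)
      by auto
    then show ?thesis using F(1) e(1) by (intro exI[of _ "insert e F"]) simp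
  qed
qed

lemma finite_cdim_orthonormal_basis:
  assumes "finite_cdim S"
  obtains F where "finite F" "orthonormal F" "cspan F = S"
  using assms gram_schmidt by (metis finite_cdim_def)

lemma closed_finite_cdim: "finite_cdim S \<Longrightarrow> closed S"
  by (metis finite_cdim_orthonormal_basis closed_cspan_orthonormal)

text \<open>An orthonormal subset of largest cardinality spans, since Gram-Schmidt would extend it
  otherwise.\<close>

lemma finite_cdimI_card_bound:
  assumes S: "csubspace S"
    and card: "\<And>F. finite F \<Longrightarrow> orthonormal F \<Longrightarrow> F \<subseteq> S \<Longrightarrow> card F \<le> n"
  shows "finite_cdim S"
proof -
  define Q where "Q F \<longleftrightarrow> finite F \<and> orthonormal F \<and> F \<subseteq> S" for F
  have "Q {}" by (simp add: Q_def orthonormal_def)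
  moreover have "\<forall>G. Q G \<longrightarrow> card G < Suc n" using card by (simp add: Q_def le_imp_less_Suc)
  ultimately have "\<exists>F. Q F \<and> (\<forall>G. Q G \<longrightarrow> card G \<le> card F)"
    by (rule Lattices_Big.ex_has_greatest_nat)
  then obtain F where F: "Q F" and max: "\<And>G. Q G \<Longrightarrow> card G \<le> card F" by blast
  have sub: "cspan F \<subseteq> S"
    using F S by (intro complex_vector.span_minimal) (auto simp: Q_def)
  have "S \<subseteq> cspan F"
  proof (rule subsetI, rule ccontr)
    fix x assume x: "x \<in> S" "x \<notin> cspan F"
    then obtain e where e: "orthonormal (insert e F)" "e \<notin> F" "e \<in> cspan (insert x F)"
      using gram_schmidt_step F unfolding Q_def by blast
    have "cspan (insert x F) \<subseteq> S"
      using F S x by (intro complex_vector.span_minimal) (auto simp: Q_def)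
    then have "Q (insert e F)" using F e by (auto simp: Q_def)
    then have "card (insert e F) \<le> card F" by (rule max)
    then show False using F e(2) by (simp add: Q_def)
  qed
  then show ?thesis
    using sub F unfolding finite_cdim_def Q_def by blast
qed

section \<open>Hilbert-Schmidt operators\<close>

text \<open>A form of the Hilbert-Schmidt condition that refers to no particular basis.  It is evidently
  stable under sums and under composition on the left, and it bounds sums over orthonormal sets
  that are not part of any given basis.\<close>

definition hs_bounded :: "('a::complex_inner \<Rightarrow> 'b::real_normed_vector) \<Rightarrow> bool" where
  "hs_bounded A \<longleftrightarrow> (\<exists>C. \<forall>F. finite F \<longrightarrow> orthonormal F \<longrightarrow> (\<Sum>f\<in>F. (norm (A f))\<^sup>2) \<le> C)"

lemma is_onb_orthonormal: "is_onb E \<Longrightarrow> orthonormal E"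
  by (auto simp: is_onb_def orthonormal_def)

text \<open>The Fourier sum is the best approximation in the span of its index set, and the span of \<open>E\<close> is
  dense.\<close>

lemma onb_parseval_approx:
  assumes E: "is_onb E" and d: "d > 0"
  obtains F where "finite F" "F \<subseteq> E" "(norm x)\<^sup>2 \<le> (\<Sum>e\<in>F. (cmod (cinner e x))\<^sup>2) + d"
proof -
  have "x \<in> closure (cspan E)" using E by (simp add: is_onb_def)
  then obtain y where y: "y \<in> cspan E" "dist y x < sqrt d"
    using d closure_approachable[of x] by (metis real_sqrt_gt_0_iff)
  then obtain F r where F: "finite F" "F \<subseteq> E" "y = (\<Sum>a\<in>F. r a *\<^sub>C a)"
    unfolding complex_vector.span_explicit by blast
  have oF: "orthonormal F"
    using is_onb_orthonormal[OF E] F(2) by (rule orthonormal_subset)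
  have "y \<in> cspan F"
    unfolding F(3) by (intro complex_vector.span_sum complex_vector.span_scale complex_vector.span_base)
  then have "fourier_sum F x - y \<in> cspan F"
    using fourier_sum_in_cspan by (intro complex_vector.span_diff)
  then have "cinner (fourier_sum F x - y) (x - fourier_sum F x) = 0"
    by (rule fourier_sum_residual_orth[OF F(1) oF])
  from norm_add_orthogonal[OF this]
  have "(norm (x - fourier_sum F x))\<^sup>2 \<le> (norm (x - y))\<^sup>2" by simp
  also have "\<dots> \<le> d"
    using y(2) d power_mono[of "dist y x" "sqrt d" 2] by (simp add: dist_norm norm_minus_commute)
  finally have "(norm x)\<^sup>2 \<le> (\<Sum>e\<in>F. (cmod (cinner e x))\<^sup>2) + d"
    using pythagoras_fourier_sum[OF F(1) oF, of x] by linarith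
  with F(1,2) show ?thesis by (rule that)
qed

text \<open>The Hilbert-Schmidt sum of the adjoint over any orthonormal set is a double sum of
  \<open>\<bar>\<langle>Ae, g\<rangle>\<bar>\<^sup>2\<close>, which Bessel's inequality bounds after exchanging the order of summation.
  Applied twice it removes the dependence on the basis.\<close>

lemma sum_norm_cadjoint_le:
  assumes E: "is_onb E" and A: "bounded_clinear A"
    and C: "\<And>F. finite F \<Longrightarrow> F \<subseteq> E \<Longrightarrow> (\<Sum>e\<in>F. (norm (A e))\<^sup>2) \<le> C"
    and G: "finite G" "orthonormal G"
  shows "(\<Sum>g\<in>G. (norm (cadjoint A g))\<^sup>2) \<le> C"
proof (rule field_le_epsilon)
  fix \<epsilon> :: real assume "\<epsilon> > 0"
  \<comment> \<open>The summand \<open>1\<close> covers the case that \<open>G\<close> is empty.\<close>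
  define d where "d = \<epsilon> / (real (card G) + 1)"
  have d: "d > 0" and dle: "real (card G) * d \<le> \<epsilon>"
    using \<open>\<epsilon> > 0\<close> by (auto simp: d_def field_simps)
  have "\<exists>F. finite F \<and> F \<subseteq> E \<and>
      (norm (cadjoint A g))\<^sup>2 \<le> (\<Sum>e\<in>F. (cmod (cinner e (cadjoint A g)))\<^sup>2) + d" for g
    using onb_parseval_approx[OF E d] by metis
  then obtain \<Phi> where \<Phi>: "\<And>g. finite (\<Phi> g)" "\<And>g. \<Phi> g \<subseteq> E"
      "\<And>g. (norm (cadjoint A g))\<^sup>2 \<le> (\<Sum>e\<in>\<Phi> g. (cmod (cinner e (cadjoint A g)))\<^sup>2) + d"
    by metis
  define F where "F = (\<Union>g\<in>G. \<Phi> g)"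
  have F: "finite F" "F \<subseteq> E" using G(1) \<Phi> by (auto simp: F_def)
  have "(\<Sum>g\<in>G. (norm (cadjoint A g))\<^sup>2) \<le> (\<Sum>g\<in>G. (\<Sum>e\<in>F. (cmod (cinner g (A e)))\<^sup>2) + d)"
  proof (rule sum_mono)
    fix g assume "g \<in> G"
    have "(norm (cadjoint A g))\<^sup>2 \<le> (\<Sum>e\<in>\<Phi> g. (cmod (cinner e (cadjoint A g)))\<^sup>2) + d" by (rule \<Phi>)
    also have "\<dots> \<le> (\<Sum>e\<in>F. (cmod (cinner e (cadjoint A g)))\<^sup>2) + d"
      using \<open>g \<in> G\<close> F(1) by (intro add_right_mono sum_mono2) (auto simp: F_def)
    also have "(\<Sum>e\<in>F. (cmod (cinner e (cadjoint A g)))\<^sup>2) = (\<Sum>e\<in>F. (cmod (cinner g (A e)))\<^sup>2)"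
      by (simp only: cinner_cadjoint[OF A, symmetric] cmod_cinner_commute)
    finally show "(norm (cadjoint A g))\<^sup>2 \<le> (\<Sum>e\<in>F. (cmod (cinner g (A e)))\<^sup>2) + d" .
  qed
  also have "\<dots> = (\<Sum>e\<in>F. \<Sum>g\<in>G. (cmod (cinner g (A e)))\<^sup>2) + real (card G) * d"
    by (simp add: sum.distrib sum.swap[of _ F G])
  also have "\<dots> \<le> (\<Sum>e\<in>F. (norm (A e))\<^sup>2) + \<epsilon>"
    by (intro add_mono sum_mono bessel G dle)
  also have "\<dots> \<le> C + \<epsilon>" using C[OF F] by simp
  finally show "(\<Sum>g\<in>G. (norm (cadjoint A g))\<^sup>2) \<le> C + \<epsilon>" .
qed

lemma
  fixes A :: "'a::chilbert_space \<Rightarrow> 'a"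
  assumes "hilbert_schmidt A"
  shows hilbert_schmidt_bounded_clinear: "bounded_clinear A"
    and hilbert_schmidt_hs_bounded: "hs_bounded A"
    and hilbert_schmidt_hs_bounded_cadjoint: "hs_bounded (cadjoint A)"
    and hilbert_schmidt_onb: "\<exists>E :: 'a set. is_onb E"
proof -
  show A: "bounded_clinear A" using assms by (simp add: hilbert_schmidt_def)
  obtain E where E: "is_onb E" "(\<lambda>e. (norm (A e))\<^sup>2) summable_on E"
    using assms by (auto simp: hilbert_schmidt_def)
  then show "\<exists>E :: 'a set. is_onb E" by blast
  define C where "C = infsum (\<lambda>e. (norm (A e))\<^sup>2) E"
  have "(\<Sum>e\<in>F. (norm (A e))\<^sup>2) \<le> C" if "finite F" "F \<subseteq> E" for F
    unfolding C_def using E(2) that by (intro finite_sum_le_infsum) auto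
  note adj = sum_norm_cadjoint_le[OF E(1) A this]
  then show "hs_bounded (cadjoint A)" unfolding hs_bounded_def by blast
  have "(\<Sum>g\<in>G. (norm (cadjoint (cadjoint A) g))\<^sup>2) \<le> C" if "finite G" "orthonormal G" for G
    using sum_norm_cadjoint_le[OF E(1) bounded_clinear_cadjoint[OF A] _ that]
      adj orthonormal_subset[OF is_onb_orthonormal[OF E(1)]] by blast
  then show "hs_bounded A" unfolding cadjoint_cadjoint[OF A] hs_bounded_def by blast
qed

lemma hilbert_schmidtI:
  fixes A :: "'a::chilbert_space \<Rightarrow> 'a"
  assumes E: "is_onb (E :: 'a set)" and A: "bounded_clinear A" and "hs_bounded A"
  shows "hilbert_schmidt A"
proof -
  obtain C where C: "\<And>F. finite F \<Longrightarrow> orthonormal F \<Longrightarrow> (\<Sum>f\<in>F. (norm (A f))\<^sup>2) \<le> C"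
    using assms(3) by (auto simp: hs_bounded_def)
  have "(\<lambda>e. (norm (A e))\<^sup>2) summable_on E"
  proof (rule nonneg_bdd_above_summable_on)
    show "bdd_above (sum (\<lambda>e. (norm (A e))\<^sup>2) ` {F. F \<subseteq> E \<and> finite F})"
      using C orthonormal_subset[OF is_onb_orthonormal[OF E]] by (intro bdd_aboveI2[where M = C]) auto
  qed simp
  then show ?thesis using A E unfolding hilbert_schmidt_def by blast
qed

lemma hilbert_schmidt_cadjoint: "hilbert_schmidt A \<Longrightarrow> hilbert_schmidt (cadjoint A)"
  using hilbert_schmidt_onb[of A] hilbert_schmidtI bounded_clinear_cadjoint
    hilbert_schmidt_bounded_clinear hilbert_schmidt_hs_bounded_cadjoint by metis

lemma hilbert_schmidt_compose_left:
  assumes B: "bounded_clinear B" and A: "hilbert_schmidt A"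
  shows "hilbert_schmidt (\<lambda>x. B (A x))"
proof -
  obtain K where K: "K > 0" "\<And>x. norm (B x) \<le> norm x * K"
    using bounded_clinear_bound[OF B] by blast
  obtain C where C: "\<And>F. finite F \<Longrightarrow> orthonormal F \<Longrightarrow> (\<Sum>f\<in>F. (norm (A f))\<^sup>2) \<le> C"
    using hilbert_schmidt_hs_bounded[OF A] by (auto simp: hs_bounded_def)
  have "(\<Sum>f\<in>F. (norm (B (A f)))\<^sup>2) \<le> K\<^sup>2 * C" if "finite F" "orthonormal F" for F
  proof -
    have "(\<Sum>f\<in>F. (norm (B (A f)))\<^sup>2) \<le> (\<Sum>f\<in>F. K\<^sup>2 * (norm (A f))\<^sup>2)"
      using power_mono[OF K(2), of _ 2] by (intro sum_mono) (simp add: power_mult_distrib mult.commute)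
    also have "\<dots> \<le> K\<^sup>2 * C"
      using C[OF that] by (simp add: sum_distrib_left[symmetric] mult_left_mono)
    finally show ?thesis .
  qed
  then have "hs_bounded (\<lambda>x. B (A x))" unfolding hs_bounded_def by blast
  then show ?thesis
    using hilbert_schmidt_onb[OF A] hilbert_schmidtI
      bounded_clinear_compose[OF B hilbert_schmidt_bounded_clinear[OF A]] by blast
qed

text \<open>\<open>A B\<close> is the adjoint of \<open>B\<^sup>* A\<^sup>*\<close>, in which the bounded factor stands on the left.\<close>

lemma hilbert_schmidt_compose_right:
  assumes A: "hilbert_schmidt A" and B: "bounded_clinear B"
  shows "hilbert_schmidt (\<lambda>x. A (B x))"
proof -
  note A' = hilbert_schmidt_bounded_clinear[OF A]
  have "cadjoint (\<lambda>x. cadjoint B (cadjoint A x)) = (\<lambda>x. A (B x))"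
    by (rule cadjoint_eqI)
      (simp add: cinner_cadjoint_right[OF A'] cinner_cadjoint_right[OF B])
  moreover have "hilbert_schmidt (\<lambda>x. cadjoint B (cadjoint A x))"
    by (rule hilbert_schmidt_compose_left[OF bounded_clinear_cadjoint[OF B] hilbert_schmidt_cadjoint[OF A]])
  ultimately show ?thesis using hilbert_schmidt_cadjoint by metis
qed

lemma hilbert_schmidt_sum:
  assumes A: "hilbert_schmidt A" and B: "hilbert_schmidt B"
  shows "hilbert_schmidt (\<lambda>x. A x + B x)"
proof -
  obtain C where C: "\<And>F. finite F \<Longrightarrow> orthonormal F \<Longrightarrow> (\<Sum>f\<in>F. (norm (A f))\<^sup>2) \<le> C"
    using hilbert_schmidt_hs_bounded[OF A] by (auto simp: hs_bounded_def)
  obtain D where D: "\<And>F. finite F \<Longrightarrow> orthonormal F \<Longrightarrow> (\<Sum>f\<in>F. (norm (B f))\<^sup>2) \<le> D"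
    using hilbert_schmidt_hs_bounded[OF B] by (auto simp: hs_bounded_def)
  have le: "(norm (a + b))\<^sup>2 \<le> 2 * (norm a)\<^sup>2 + 2 * (norm b)\<^sup>2" for a b :: 'a
  proof -
    have "(norm (a + b))\<^sup>2 \<le> (norm a + norm b)\<^sup>2" by (intro power_mono norm_triangle_ineq) simp
    also have "\<dots> \<le> 2 * (norm a)\<^sup>2 + 2 * (norm b)\<^sup>2"
      using sum_squares_bound[of "norm a" "norm b"] by (simp add: power2_sum)
    finally show ?thesis .
  qed
  have "(\<Sum>f\<in>F. (norm (A f + B f))\<^sup>2) \<le> 2 * C + 2 * D" if "finite F" "orthonormal F" for F
  proof -
    have "(\<Sum>f\<in>F. (norm (A f + B f))\<^sup>2) \<le> (\<Sum>f\<in>F. 2 * (norm (A f))\<^sup>2 + 2 * (norm (B f))\<^sup>2)"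
      by (intro sum_mono le)
    also have "\<dots> \<le> 2 * C + 2 * D"
      using C[OF that] D[OF that] by (simp add: sum.distrib sum_distrib_left[symmetric])
    finally show ?thesis .
  qed
  then have "hs_bounded (\<lambda>x. A x + B x)" unfolding hs_bounded_def by blast
  then show ?thesis
    using hilbert_schmidt_onb[OF A] hilbert_schmidtI bounded_clinear_sum
      hilbert_schmidt_bounded_clinear A B by blast
qed

lemma hilbert_schmidt_diff:
  assumes A: "hilbert_schmidt A" and B: "hilbert_schmidt B"
  shows "hilbert_schmidt (\<lambda>x. A x - B x)"
proof -
  have "hilbert_schmidt (\<lambda>x. (\<lambda>y. 0 - y) (B x))"
    by (rule hilbert_schmidt_compose_left[OF _ B], rule bounded_clinearI[where K = 1])
      (auto simp: complex_vector.scale_minus_right)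
  from hilbert_schmidt_sum[OF A this] show ?thesis by simp
qed

lemma hilbert_schmidt_projection_finite_cdim:
  assumes h: "csubspace h" "finite_cdim h" and E: "is_onb (E :: 'a::chilbert_space set)"
  shows "hilbert_schmidt (proj_onto (h :: 'a set))"
proof -
  obtain H where H: "finite H" "orthonormal H" "cspan H = h"
    using finite_cdim_orthonormal_basis[OF h(2)] .
  have eq: "proj_onto h = fourier_sum H"
    using fourier_sum_in_cspan[of H] fourier_sum_residual_orth[OF H(1,2)] H(3)
    by (intro ext proj_onto_eqI h) auto
  have "(\<Sum>f\<in>F. (norm (fourier_sum H f))\<^sup>2) \<le> real (card H)" if F: "finite F" "orthonormal F" for F
  proof -
    have "(\<Sum>f\<in>F. (norm (fourier_sum H f))\<^sup>2) = (\<Sum>e\<in>H. \<Sum>f\<in>F. (cmod (cinner f e))\<^sup>2)"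
      unfolding norm_fourier_sum[OF H(1,2)]
      by (subst sum.swap) (intro sum.cong refl arg_cong[where f = "\<lambda>r. r\<^sup>2"] cmod_cinner_commute)
    also have "\<dots> \<le> (\<Sum>e\<in>H. (norm e)\<^sup>2)" by (intro sum_mono bessel F)
    also have "\<dots> = real (card H)" using H(2) by (simp add: orthonormal_def)
    finally show ?thesis .
  qed
  then have "hs_bounded (fourier_sum H)" unfolding hs_bounded_def by blast
  then show ?thesis
    unfolding eq using bounded_clinear_fourier_sum[OF H(1,2)] E by (intro hilbert_schmidtI)
qed

text \<open>A Hilbert-Schmidt operator is small off a finite set: take a finite orthonormal set whose
  sum is within \<open>\<epsilon>\<^sup>2\<close> of the supremum; a further unit vector can add at most \<open>\<epsilon>\<^sup>2\<close>.\<close>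

lemma hs_bounded_small_off_finite:
  fixes A :: "'a::complex_inner \<Rightarrow> 'b::complex_inner"
  assumes "hs_bounded A" "bounded_clinear A" and \<epsilon>: "\<epsilon> > 0"
  obtains F where "finite F" "\<And>x. (\<And>f. f \<in> F \<Longrightarrow> cinner f x = 0) \<Longrightarrow> norm (A x) \<le> \<epsilon> * norm x"
proof -
  define X where "X = {\<Sum>f\<in>F. (norm (A f))\<^sup>2 |F. finite F \<and> orthonormal F}"
  have "orthonormal ({} :: 'a set)" by (simp add: orthonormal_def)
  then have X1: "X \<noteq> {}" unfolding X_def by blast
  have X2: "bdd_above X"
    using assms(1) unfolding X_def hs_bounded_def bdd_above_def by blast
  have "Sup X - \<epsilon>\<^sup>2 < Sup X" using \<epsilon> by simp
  then obtain r where "r \<in> X" "Sup X - \<epsilon>\<^sup>2 < r"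
    using less_cSup_iff[OF X1 X2] by blast
  then obtain F where F: "finite F" "orthonormal F" "Sup X - \<epsilon>\<^sup>2 < (\<Sum>f\<in>F. (norm (A f))\<^sup>2)"
    unfolding X_def by blast
  have "norm (A x) \<le> \<epsilon> * norm x" if orth: "\<And>f. f \<in> F \<Longrightarrow> cinner f x = 0" for x
  proof (cases "x = 0")
    case False
    define e where "e = complex_of_real (inverse (norm x)) *\<^sub>C x"
    have ne: "norm e = 1" using False by (simp add: e_def norm_scaleC norm_inverse)
    have oe: "cinner f e = 0" if "f \<in> F" for f
      using orth[OF that] by (simp add: e_def cinner_scaleC_right)
    have "e \<notin> F" using ne oe by force
    have "orthonormal (insert e F)" using F(2) ne oe by (rule orthonormal_insert)
    then have "(\<Sum>f\<in>insert e F. (norm (A f))\<^sup>2) \<in> X" using F(1) unfolding X_def by blast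
    then have "(norm (A e))\<^sup>2 + (\<Sum>f\<in>F. (norm (A f))\<^sup>2) \<le> Sup X"
      using cSup_upper[OF _ X2] \<open>e \<notin> F\<close> F(1) by fastforce
    then have "(norm (A e))\<^sup>2 \<le> \<epsilon>\<^sup>2" using F(3) by simp
    then have "norm (A e) \<le> \<epsilon>" using \<epsilon> by simp
    moreover have "norm (A e) = norm (A x) / norm x"
      by (simp add: e_def bounded_clinear_scaleC[OF assms(2)] norm_scaleC norm_inverse divide_inverse mult.commute)
    ultimately show ?thesis using False by (simp add: pos_divide_le_eq)
  qed (simp add: bounded_clinear_zero[OF assms(2)])
  with F(1) show ?thesis by (rule that)
qed

section \<open>Self-adjoint operators with closed range\<close>

lemma subspace_if_csubspace: "csubspace S \<Longrightarrow> subspace S"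
  by (simp add: subspace_def scaleR_scaleC complex_vector.subspace_0 complex_vector.subspace_add
      complex_vector.subspace_scale)

lemma closed_image_bounded_below:
  fixes A :: "'a::chilbert_space \<Rightarrow> 'a"
  assumes A: "bounded_clinear A" and V: "csubspace V" "closed V"
    and c: "c > 0" "\<And>v. v \<in> V \<Longrightarrow> c * norm v \<le> norm (A v)"
  shows "closed (A ` V)"
proof -
  have "complete (A ` V)"
    by (rule complete_isometric_image[OF c(1) subspace_if_csubspace[OF V(1)]
          bounded_clinear_bounded_linear[OF A]])
      (use c(2) V(2) in \<open>auto simp: complete_eq_closed\<close>)
  then show ?thesis by (rule complete_imp_closed)
qed

text \<open>One dimension can be added at a time.  If \<open>b\<close> lies outside \<open>V'\<close>, then \<open>A b\<close> has positive distance
  to the closed subspace \<open>A V'\<close> by injectivity, so \<open>\<parallel>A (v + t b)\<parallel>\<close> controls \<open>\<bar>t\<bar>\<close>, hence also \<open>\<parallel>A v\<parallel>\<close>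
  and \<open>\<parallel>v\<parallel>\<close>.\<close>

lemma bounded_below_if_bounded_below_off_finite:
  fixes A :: "'a::chilbert_space \<Rightarrow> 'a"
  assumes A: "bounded_clinear A" and "finite F" and "csubspace V" "closed V"
    and "\<And>v. v \<in> V \<Longrightarrow> A v = 0 \<Longrightarrow> v = 0"
    and "c > 0" "\<And>v. v \<in> V \<Longrightarrow> \<forall>f\<in>F. cinner f v = 0 \<Longrightarrow> c * norm v \<le> norm (A v)"
  shows "\<exists>c>0. \<forall>v\<in>V. c * norm v \<le> norm (A v)"
  using assms(2-)
proof (induction F arbitrary: V rule: finite_induct)
  case empty
  then show ?case by (intro exI[of _ c]) simp
next
  case (insert e F)
  note V = insert.prems(1,2) and inj = insert.prems(3)
  define V' where "V' = V \<inter> {v. \<forall>s\<in>{e}. cinner s v = 0}"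
  have V': "csubspace V'" "closed V'"
    unfolding V'_def
    by (intro complex_vector.subspace_inter csubspace_orthogonal V closed_Int closed_orthogonal)+
  have "\<exists>c>0. \<forall>v\<in>V'. c * norm v \<le> norm (A v)"
    by (rule insert.IH[OF V']) (use insert.prems in \<open>auto simp: V'_def\<close>)
  then obtain c' where c': "c' > 0" "\<And>v. v \<in> V' \<Longrightarrow> c' * norm v \<le> norm (A v)" by blast
  show ?case
  proof (cases "V = V'")
    case True
    with c' show ?thesis by blast
  next
    case False
    then obtain b where b: "b \<in> V" "cinner e b \<noteq> 0" by (auto simp: V'_def)
    have AV': "csubspace (A ` V')" "closed (A ` V')"
      using csubspace_image[OF A V'(1)] closed_image_bounded_below[OF A V' c'] by auto
    define w where "w = A b - proj_onto (A ` V') (A b)"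
    have w0: "w \<noteq> 0"
    proof
      assume "w = 0"
      then obtain v where v: "v \<in> V'" "A b = A v"
        using proj_onto_mem[OF AV', of "A b"] by (auto simp: w_def)
      have "b - v \<in> V"
        using v(1) b(1) V(1) by (simp add: V'_def complex_vector.subspace_diff)
      then have "b - v = 0"
        by (rule inj) (simp add: bounded_clinear_diff[OF A] v(2))
      with v b show False by (auto simp: V'_def)
    qed
    define K where "K = 1 / c' + (norm (A b) / c' + norm b) / norm w"
    have "K > 0" unfolding K_def using c'(1) w0 by (intro add_pos_nonneg) auto
    have bound: "norm v \<le> K * norm (A v)" if "v \<in> V" for v
    proof -
      define t where "t = cinner e v / cinner e b"
      define u where "u = v - t *\<^sub>C b"
      have u: "u \<in> V'" using that b V(1)
        by (simp add: V'_def u_def t_def cinner_simps complex_vector.subspace_diff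
            complex_vector.subspace_scale)
      define y where "y = A u + t *\<^sub>C proj_onto (A ` V') (A b)"
      have y: "y \<in> A ` V'"
        unfolding y_def using u proj_onto_mem[OF AV'] AV'(1)
        by (intro complex_vector.subspace_add complex_vector.subspace_scale) auto
      have Av: "A v = y + t *\<^sub>C w"
        by (simp add: y_def w_def u_def bounded_clinear_diff[OF A] bounded_clinear_scaleC[OF A]
            complex_vector.scale_right_diff_distrib)
      have "cinner y (t *\<^sub>C w) = 0"
        using proj_onto_orth[OF AV' y] by (simp add: w_def cinner_scaleC_right)
      from norm_add_orthogonal[OF this]
      have "(norm (t *\<^sub>C w))\<^sup>2 \<le> (norm (A v))\<^sup>2" by (simp add: Av)
      then have "norm (t *\<^sub>C w) \<le> norm (A v)" by simp
      then have t: "cmod t \<le> norm (A v) / norm w"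
        using w0 by (simp add: norm_scaleC field_simps)
      have "norm (A u) \<le> norm (A v) + norm (t *\<^sub>C A b)"
        unfolding u_def bounded_clinear_diff[OF A] bounded_clinear_scaleC[OF A]
        by (rule norm_triangle_ineq4)
      then have u': "norm u \<le> (norm (A v) + cmod t * norm (A b)) / c'"
        using c'(2)[OF u] c'(1) by (simp add: norm_scaleC field_simps)
      have "norm v \<le> norm u + cmod t * norm b"
        using norm_triangle_ineq[of u "t *\<^sub>C b"] by (simp add: u_def norm_scaleC)
      also have "\<dots> \<le> norm (A v) / c' + cmod t * (norm (A b) / c' + norm b)"
        using u' by (simp add: distrib_left add_divide_distrib)
      also have "\<dots> \<le> norm (A v) / c' + norm (A v) / norm w * (norm (A b) / c' + norm b)"
        using c'(1) by (intro add_left_mono mult_right_mono t) auto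
      also have "\<dots> = K * norm (A v)" by (simp add: K_def field_simps)
      finally show ?thesis .
    qed
    show ?thesis
      using \<open>K > 0\<close> bound by (intro exI[of _ "1 / K"]) (auto simp: field_simps)
  qed
qed

definition ker_complement :: "('a::chilbert_space \<Rightarrow> 'a) \<Rightarrow> ('a \<Rightarrow> 'a) \<Rightarrow> 'a set" where
  "ker_complement Q A = {f \<in> range Q. \<forall>n\<in>ker_on (range Q) A. cinner n f = 0}"

lemma
  assumes "orth_projection Q"
  shows csubspace_ker_complement: "csubspace (ker_complement Q A)"
    and closed_ker_complement: "closed (ker_complement Q A)"
proof -
  have eq: "ker_complement Q A = range Q \<inter> {f. \<forall>n\<in>ker_on (range Q) A. cinner n f = 0}"
    by (auto simp: ker_complement_def)
  show "csubspace (ker_complement Q A)" "closed (ker_complement Q A)"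
    unfolding eq
    by (intro complex_vector.subspace_inter csubspace_orthogonal csubspace_range_projection assms
        closed_Int closed_orthogonal closed_range_projection)+
qed

lemma range_inverse_projection:
  "orth_projection Q \<Longrightarrow> range_inverse Q A (Q f) = range_inverse Q A f"
  by (simp add: range_inverse_def orth_projection_idem)

text \<open>As \<open>A\<close> is self-adjoint, \<open>Q A = A\<close> also gives \<open>A Q = A\<close>: the operator acts on the range of \<open>Q\<close> and is
  extended by zero.\<close>

locale self_adjoint_bounded_below =
  fixes Q A :: "'a::chilbert_space \<Rightarrow> 'a"
  assumes Q: "orth_projection Q" and A: "bounded_clinear A"
    and Q_A: "Q (A f) = A f"
    and sym: "cinner (A f) g = cinner f (A g)"
    and bounded_below: "\<exists>c>0. \<forall>f\<in>ker_complement Q A. c * norm f \<le> norm (A f)"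
begin

lemma csubspace_kernel: "csubspace (ker_on (range Q) A)"
  using csubspace_range_projection[OF Q]
  by (auto simp: ker_on_def complex_vector.subspace_def bounded_clinear_zero[OF A]
      bounded_clinear_add[OF A] bounded_clinear_scaleC[OF A])

lemma closed_kernel: "closed (ker_on (range Q) A)"
proof -
  have "ker_on (range Q) A = range Q \<inter> {f. A f = 0}" by (auto simp: ker_on_def)
  also have "closed \<dots>"
    by (intro closed_Int closed_range_projection[OF Q] closed_Collect_eq linear_continuous_on
        bounded_clinear_bounded_linear[OF A] continuous_on_const)
  finally show ?thesis .
qed

lemma kernel_cap_ker_complement: "f \<in> ker_on (range Q) A \<Longrightarrow> f \<in> ker_complement Q A \<Longrightarrow> f = 0"
  by (auto simp: ker_complement_def)

lemma image_in_ker_complement: "A f \<in> ker_complement Q A"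
  using mem_range_projection[OF Q] Q_A
  by (auto simp: ker_complement_def ker_on_def sym[symmetric])

text \<open>The image of the complement is closed in it, and a vector of the complement orthogonal to the
  image is annihilated by the self-adjoint \<open>A\<close>, hence zero.\<close>

lemma image_ker_complement: "A ` ker_complement Q A = ker_complement Q A"
proof
  let ?M = "ker_complement Q A"
  note M = csubspace_ker_complement[OF Q] closed_ker_complement[OF Q]
  have AM: "csubspace (A ` ?M)" "closed (A ` ?M)"
    using csubspace_image[OF A M(1)] closed_image_bounded_below[OF A M] bounded_below by blast+
  show "?M \<subseteq> A ` ?M"
  proof
    fix f assume f: "f \<in> ?M"
    define w where "w = f - proj_onto (A ` ?M) f"
    have "A ` ?M \<subseteq> ?M" using image_in_ker_complement by blast
    then have wM: "w \<in> ?M"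
      unfolding w_def using f proj_onto_mem[OF AM, of f] M(1) complex_vector.subspace_diff by blast
    have "cinner (A (A w)) w = 0"
      using proj_onto_orth[OF AM] image_in_ker_complement by (simp add: w_def)
    then have "A w = 0" using sym[of "A w" w] by simp
    moreover have "w \<in> range Q" using wM by (simp add: ker_complement_def)
    ultimately have "w = 0" using wM by (intro kernel_cap_ker_complement) (simp_all add: ker_on_def)
    then show "f \<in> A ` ?M" using proj_onto_mem[OF AM, of f] by (simp add: w_def)
  qed
qed (use image_in_ker_complement in blast)

lemma image_range: "A ` range Q = ker_complement Q A"
proof -
  have "ker_complement Q A \<subseteq> range Q" by (auto simp: ker_complement_def)
  then show ?thesis using image_ker_complement image_in_ker_complement by blast
qed

lemma bij_betw_ker_complement: "bij_betw A (ker_complement Q A) (ker_complement Q A)"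
  unfolding bij_betw_def
proof
  show "inj_on A (ker_complement Q A)"
  proof (rule inj_onI)
    fix f g assume fg: "f \<in> ker_complement Q A" "g \<in> ker_complement Q A" "A f = A g"
    then have "f - g \<in> ker_complement Q A"
      using csubspace_ker_complement[OF Q] complex_vector.subspace_diff by blast
    then obtain c where "c > 0" "c * norm (f - g) \<le> norm (A (f - g))"
      using bounded_below by blast
    then show "f = g"
      using fg(3) by (simp add: bounded_clinear_diff[OF A] mult_le_0_iff)
  qed
qed (rule image_ker_complement)

lemma range_inverse_unique:
  assumes "g \<in> ker_complement Q A" "Q f - A g \<in> ker_on (range Q) A"
    and "g' \<in> ker_complement Q A" "Q f - A g' \<in> ker_on (range Q) A"
  shows "g = g'"
proof -
  have "(Q f - A g) - (Q f - A g') \<in> ker_on (range Q) A"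
    using assms csubspace_kernel complex_vector.subspace_diff by blast
  moreover have "(Q f - A g) - (Q f - A g') = A (g' - g)" by (simp add: bounded_clinear_diff[OF A])
  ultimately have "A (g' - g) = 0"
    using image_in_ker_complement kernel_cap_ker_complement by metis
  then show ?thesis
    using assms(1,3) bij_betw_ker_complement by (auto simp: bounded_clinear_diff[OF A] bij_betw_def inj_on_def)
qed

lemma range_inverse_eqI:
  assumes "g \<in> ker_complement Q A" "Q f - A g \<in> ker_on (range Q) A"
  shows "range_inverse Q A f = g"
  unfolding range_inverse_def image_range
proof (rule the_equality)
  show "g \<in> ker_complement Q A \<and> (\<exists>h\<in>ker_on (range Q) A. Q f = A g + h)"
    using assms by (intro conjI bexI[of _ "Q f - A g"]) auto
  show "g' = g" if "g' \<in> ker_complement Q A \<and> (\<exists>h\<in>ker_on (range Q) A. Q f = A g' + h)" for g'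
    using that assms range_inverse_unique[of g' f g] by auto
qed

text \<open>The decomposition in the definition of the inverse exists: the component of \<open>Q f\<close> orthogonal to
  the kernel lies in the image.\<close>

lemma range_inverse_mem: "range_inverse Q A f \<in> ker_complement Q A"
  and range_inverse_residual: "Q f - A (range_inverse Q A f) \<in> ker_on (range Q) A"
proof -
  let ?p = "proj_onto (ker_on (range Q) A) (Q f)"
  note p = proj_onto_mem[OF csubspace_kernel closed_kernel, of "Q f"]
    proj_onto_orth[OF csubspace_kernel closed_kernel, of _ "Q f"]
  have "Q f - ?p \<in> range Q"
    using p(1) csubspace_range_projection[OF Q] complex_vector.subspace_diff
    unfolding ker_on_def by blast
  then have "Q f - ?p \<in> ker_complement Q A"
    using p(2) by (simp add: ker_complement_def)
  then obtain g where g: "g \<in> ker_complement Q A" "Q f - ?p = A g"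
    using image_ker_complement by blast
  have "Q f - A g = ?p" using g(2) by (simp add: algebra_simps)
  then have "Q f - A g \<in> ker_on (range Q) A" using p(1) by simp
  moreover from g(1) this have "range_inverse Q A f = g" by (rule range_inverse_eqI)
  ultimately show "range_inverse Q A f \<in> ker_complement Q A"
      "Q f - A (range_inverse Q A f) \<in> ker_on (range Q) A"
    using g(1) by simp_all
qed

lemma bounded_clinear_range_inverse: "bounded_clinear (range_inverse Q A)"
proof -
  obtain c where c: "c > 0" "\<And>f. f \<in> ker_complement Q A \<Longrightarrow> c * norm f \<le> norm (A f)"
    using bounded_below by blast
  show ?thesis
  proof (rule bounded_clinearI[where K = "1 / c"])
    note mem = range_inverse_mem and res = range_inverse_residual
      and Q' = orth_projection_bounded[OF Q]
    fix f g k
    let ?r = "range_inverse Q A"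
    have "Q (f + g) - A (?r f + ?r g) = (Q f - A (?r f)) + (Q g - A (?r g))"
      by (simp add: bounded_clinear_add[OF A] bounded_clinear_add[OF Q'])
    then show "?r (f + g) = ?r f + ?r g"
      using mem res csubspace_kernel csubspace_ker_complement[OF Q]
      by (intro range_inverse_eqI) (simp_all add: complex_vector.subspace_add)
    have "Q (k *\<^sub>C f) - A (k *\<^sub>C ?r f) = k *\<^sub>C (Q f - A (?r f))"
      by (simp add: bounded_clinear_scaleC[OF A] bounded_clinear_scaleC[OF Q']
          complex_vector.scale_right_diff_distrib)
    then show "?r (k *\<^sub>C f) = k *\<^sub>C ?r f"
      using mem res csubspace_kernel csubspace_ker_complement[OF Q]
      by (intro range_inverse_eqI) (simp_all add: complex_vector.subspace_scale)
    have "cinner (Q f - A (?r f)) (A (?r f)) = 0"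
      using res[of f] image_in_ker_complement[of "?r f"] by (auto simp: ker_complement_def)
    from norm_add_orthogonal[OF this] have "(norm (A (?r f)))\<^sup>2 \<le> (norm (Q f))\<^sup>2" by simp
    then have "norm (A (?r f)) \<le> norm f"
      using norm_projection_le[OF Q, of f] by simp
    then show "norm (?r f) \<le> norm f * (1 / c)"
      using c(2)[OF mem, of f] c(1) by (simp add: field_simps)
  qed
qed

end

section \<open>Conjugations and basis projections\<close>

locale conjugated_space =
  fixes J :: "'a::chilbert_space \<Rightarrow> 'a"
  assumes J: "conjugation J"
begin

lemma J_add: "J (f + g) = J f + J g"
  and J_scaleC: "J (c *\<^sub>C f) = cnj c *\<^sub>C J f"
  and cinner_J_J: "cinner (J f) (J g) = cinner g f"
  and J_J [simp]: "J (J f) = f"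
  using J by (auto simp: conjugation_def)

lemma J_zero [simp]: "J 0 = 0"
  using J_add[of 0 0] by simp

lemma J_diff: "J (f - g) = J f - J g"
  using J_add[of "f - g" g] by (simp add: algebra_simps)

lemma J_minus: "J (- f) = - J f"
  using J_diff[of 0 f] by simp

lemma J_eq_iff [simp]: "J f = J g \<longleftrightarrow> f = g"
  by (metis J_J)

lemma cinner_J_left: "cinner (J f) g = cinner (J g) f"
  using cinner_J_J[of f "J g"] by simp

lemma cinner_J_right: "cinner f (J g) = cinner g (J f)"
  using cinner_J_J[of "J f" g] by simp

lemma norm_J: "norm (J f) = norm f"
proof -
  have "complex_of_real ((norm (J f))\<^sup>2) = complex_of_real ((norm f)\<^sup>2)"
    unfolding cinner_self[symmetric] by (rule cinner_J_J)
  then have "(norm (J f))\<^sup>2 = (norm f)\<^sup>2" by (simp only: of_real_eq_iff)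
  then show ?thesis by simp
qed

lemma bounded_clinear_conj_op:
  assumes A: "bounded_clinear A"
  shows "bounded_clinear (conj_op J A)"
proof -
  obtain K where "\<And>x. norm (A x) \<le> norm x * K" using bounded_clinear_bound[OF A] by blast
  from this[of "J _"] show ?thesis
    by (intro bounded_clinearI[where K = K])
      (simp_all add: conj_op_def J_add J_scaleC bounded_clinear_add[OF A] bounded_clinear_scaleC[OF A]
        norm_J)
qed

lemma orth_projection_conj_op:
  assumes P: "orth_projection P"
  shows "orth_projection (conj_op J P)"
  unfolding orth_projection_iff
proof (intro conjI allI bounded_clinear_conj_op orth_projection_bounded[OF P])
  fix f g
  show "conj_op J P (conj_op J P f) = conj_op J P f"
    by (simp add: conj_op_def orth_projection_idem[OF P])
  show "cinner (conj_op J P f) g = cinner f (conj_op J P g)"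
    unfolding conj_op_def cinner_J_left[of "P (J f)"] cinner_J_right[of f]
    by (simp only: orth_projection_sym[OF P])
qed

lemma orthonormal_image_J: "orthonormal F \<Longrightarrow> orthonormal (J ` F)"
  by (auto simp: orthonormal_def norm_J cinner_J_J)

lemma hilbert_schmidt_conj_op:
  assumes A: "hilbert_schmidt A"
  shows "hilbert_schmidt (conj_op J A)"
proof -
  obtain C where C: "\<And>F. finite F \<Longrightarrow> orthonormal F \<Longrightarrow> (\<Sum>f\<in>F. (norm (A f))\<^sup>2) \<le> C"
    using hilbert_schmidt_hs_bounded[OF A] by (auto simp: hs_bounded_def)
  have "(\<Sum>f\<in>F. (norm (conj_op J A f))\<^sup>2) \<le> C" if "finite F" "orthonormal F" for F
  proof -
    have "(\<Sum>f\<in>F. (norm (conj_op J A f))\<^sup>2) = (\<Sum>f\<in>J ` F. (norm (A f))\<^sup>2)"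
      by (subst sum.reindex) (auto simp: inj_on_def conj_op_def norm_J)
    also have "\<dots> \<le> C" using that by (intro C orthonormal_image_J) auto
    finally show ?thesis .
  qed
  then have "hs_bounded (conj_op J A)" unfolding hs_bounded_def by blast
  then show ?thesis
    using hilbert_schmidt_onb[OF A]
      hilbert_schmidtI[OF _ bounded_clinear_conj_op[OF hilbert_schmidt_bounded_clinear[OF A]]]
    by blast
qed

text \<open>Antisymmetry of \<open>T\<close> is antisymmetry of the bilinear form \<open>(f, g) \<mapsto> \<langle>J f, T g\<rangle>\<close>, in which no
  adjoint occurs.\<close>

lemma antisymmetric_op_iff:
  assumes T: "bounded_clinear T"
  shows "antisymmetric_op J T \<longleftrightarrow> (\<forall>f g. cinner (J f) (T g) = - cinner (J g) (T f))"
proof -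
  have eq: "cinner (J f) (T g) = cinner (J g) (J (cadjoint T (J f)))" for f g
    by (simp add: cinner_J_J cinner_cadjoint_right[OF T])
  show ?thesis
  proof
    assume "antisymmetric_op J T"
    then have "J (cadjoint T (J f)) = - T f" for f
      by (auto simp: antisymmetric_op_def transpose_op_def conj_op_def dest: fun_cong[of _ _ f])
    then show "\<forall>f g. cinner (J f) (T g) = - cinner (J g) (T f)"
      using eq by (metis cinner_minus_right)
  next
    assume *: "\<forall>f g. cinner (J f) (T g) = - cinner (J g) (T f)"
    have "J (cadjoint T (J f)) = - T f" for f
    proof (rule cinner_eq_imp_eq)
      fix g
      show "cinner g (J (cadjoint T (J f))) = cinner g (- T f)"
        using eq[of f "J g"] *[rule_format, of f "J g"] by (simp add: cinner_minus_right)
    qed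
    then show "antisymmetric_op J T"
      by (simp add: antisymmetric_op_def transpose_op_def conj_op_def fun_eq_iff)
  qed
qed

lemma basis_projection_J:
  assumes "basis_projection J P"
  shows "P (J f) = J (f - P f)"
proof -
  have "P (J f) + J (P f) = J f"
    using assms unfolding basis_projection_def conj_op_def by (metis J_J)
  then show ?thesis by (simp add: J_diff algebra_simps)
qed

lemma basis_projectionI:
  assumes "orth_projection P" "\<And>f. P (J f) = J (f - P f)"
  shows "basis_projection J P"
  using assms by (simp add: basis_projection_def conj_op_def J_diff)

end

locale reference_projection = conjugated_space J for J :: "'a::chilbert_space \<Rightarrow> 'a" +
  fixes P1 :: "'a \<Rightarrow> 'a"
  assumes P1: "basis_projection J P1"
begin

lemma P1_orth: "orth_projection P1"
  using P1 by (simp add: basis_projection_def)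

lemmas P1_bounded = orth_projection_bounded[OF P1_orth]
lemmas P1_idem [simp] = orth_projection_idem[OF P1_orth]
lemmas P1_sym = orth_projection_sym[OF P1_orth]
lemmas P1_add = bounded_clinear_add[OF P1_bounded]
lemmas P1_diff = bounded_clinear_diff[OF P1_bounded]
lemmas P1_zero = bounded_clinear_zero[OF P1_bounded]
lemmas P1_J = basis_projection_J[OF P1]
lemmas mem_range_P1 = mem_range_projection[OF P1_orth]

lemma cinner_P1_left: "P1 f = f \<Longrightarrow> cinner f (P1 g) = cinner f g"
  using P1_sym[of f g] by simp

lemma P1_J_fixed: "P1 f = f \<Longrightarrow> P1 (J f) = 0"
  by (simp add: P1_J)

lemma orthogonal_P1_kernel: "P1 f = f \<Longrightarrow> P1 g = 0 \<Longrightarrow> cinner f g = 0 \<and> cinner g f = 0"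
  using P1_sym[of f g] cinner_eq_0_commute[of f g] by auto

lemma block_off_diagonal_iff:
  "T = block (compl_proj P1) T P1 \<longleftrightarrow> (\<forall>f. P1 (T f) = 0 \<and> T (P1 f) = T f)"
proof
  assume T: "T = block (compl_proj P1) T P1"
  have eq: "T f = T (P1 f) - P1 (T (P1 f))" for f
    using fun_cong[OF T, of f] by (simp add: block_def compl_proj_def)
  show "\<forall>f. P1 (T f) = 0 \<and> T (P1 f) = T f"
    using eq by (metis P1_diff P1_idem cancel_comm_monoid_add_class.diff_cancel)
next
  assume "\<forall>f. P1 (T f) = 0 \<and> T (P1 f) = T f"
  then show "T = block (compl_proj P1) T P1"
    by (simp add: fun_eq_iff block_def compl_proj_def)
qed

end

section \<open>The projection onto the graph of an antisymmetric operator\<close>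

locale antisymmetric_hs = reference_projection J P1 for J P1 :: "'a::chilbert_space \<Rightarrow> 'a" +
  fixes T :: "'a \<Rightarrow> 'a"
  assumes T_mem: "T \<in> hs_antisymmetric J P1"
begin

lemma T_hs: "hilbert_schmidt T"
  using T_mem by (simp add: hs_antisymmetric_def)

lemma P1_T [simp]: "P1 (T f) = 0" and T_P1 [simp]: "T (P1 f) = T f"
  using T_mem block_off_diagonal_iff[of T] by (simp_all add: hs_antisymmetric_def)

lemmas T_bounded = hilbert_schmidt_bounded_clinear[OF T_hs]
lemmas T_diff = bounded_clinear_diff[OF T_bounded]

abbreviation T' where "T' \<equiv> cadjoint T"

lemmas T'_bounded = bounded_clinear_cadjoint[OF T_bounded]
lemmas T'_add = bounded_clinear_add[OF T'_bounded]
lemmas T'_diff = bounded_clinear_diff[OF T'_bounded]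
lemmas cinner_T = cinner_cadjoint[OF T_bounded]

lemma P1_T' [simp]: "P1 (T' f) = T' f"
  by (rule cinner_eq_imp_eq) (simp add: P1_sym[symmetric] cinner_T[symmetric])

lemma T'_P1 [simp]: "T' (P1 f) = 0"
  by (rule cinner_eq_imp_eq) (simp add: cinner_T[symmetric] P1_sym[symmetric])

lemma T'_J: "T' (J f) = - J (T f)" and T_J: "T (J f) = - J (T' f)"
proof -
  have eq: "J (T' (J f)) = - T f" for f
    using T_mem by (auto simp: hs_antisymmetric_def antisymmetric_op_def transpose_op_def conj_op_def
        dest: fun_cong[of _ _ f])
  show "T' (J f) = - J (T f)"
    using arg_cong[OF eq[of f], of J] by (simp add: J_minus)
  show "T (J f) = - J (T' f)"
    using eq[of "J f"] by simp
qed

abbreviation G where "G \<equiv> (\<lambda>f. P1 f + T f) ` range P1"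

text \<open>As \<open>T\<close> sees only the \<open>P1\<close>-component and maps into the kernel of \<open>P1\<close>, the graph is the fixed
  space of a bounded operator; in particular it is closed.\<close>

lemma mem_graph_iff: "x \<in> G \<longleftrightarrow> P1 x + T x = x"
proof
  assume "x \<in> G"
  then obtain f where "x = P1 f + T f" by auto
  then show "P1 x + T x = x"
    by (metis P1_T P1_add P1_idem T_P1 add.right_neutral)
next
  assume "P1 x + T x = x"
  then have "x = P1 (P1 x) + T (P1 x)" by simp
  then show "x \<in> G" by blast
qed

lemma csubspace_graph: "csubspace G"
  by (intro csubspace_image bounded_clinear_sum P1_bounded T_bounded
      csubspace_range_projection P1_orth)

lemma closed_graph: "closed G"
proof -
  have "G = {x. P1 x + T x = x}" using mem_graph_iff by blast
  also have "closed \<dots>"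
    by (intro closed_Collect_eq linear_continuous_on continuous_on_id
        bounded_clinear_bounded_linear bounded_clinear_sum P1_bounded T_bounded)
  finally show ?thesis .
qed

lemma orthogonal_graph_iff: "(\<forall>s\<in>G. cinner s x = 0) \<longleftrightarrow> P1 x + T' x = 0"
proof -
  have eq: "cinner (P1 f + T f) x = cinner f (P1 x + T' x)" for f
    by (simp add: cinner_add_left cinner_add_right P1_sym cinner_T)
  show ?thesis
  proof
    assume *: "\<forall>s\<in>G. cinner s x = 0"
    have "P1 (P1 x + T' x) = P1 x + T' x" by (simp add: P1_add)
    then have "P1 x + T' x \<in> range P1" by (metis rangeI)
    then show "P1 x + T' x = 0" using * eq[of "P1 x + T' x"] by fastforce
  qed (use eq in auto)
qed

text \<open>The orthogonal complement of the graph is its conjugate: this is what antisymmetry of \<open>T\<close>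
  means geometrically, and it makes the graph projection a basis projection.\<close>

lemma orthogonal_graph_iff_J: "(\<forall>s\<in>G. cinner s x = 0) \<longleftrightarrow> J x \<in> G"
proof -
  have "P1 (J x) + T (J x) = J x \<longleftrightarrow> J (P1 x + T' x) = J 0"
    by (simp add: P1_J T_J J_add J_diff algebra_simps)
  then show ?thesis by (simp only: orthogonal_graph_iff mem_graph_iff J_eq_iff)
qed

abbreviation PT where "PT \<equiv> graph_proj P1 T"

lemma PT_orth: "orth_projection PT"
  and range_PT: "range PT = G"
  and PT_mem: "PT x \<in> G"
  and PT_residual: "s \<in> G \<Longrightarrow> cinner s (x - PT x) = 0"
  unfolding graph_proj_def
  by (rule orth_projection_proj_onto[OF csubspace_graph closed_graph]
      range_proj_onto[OF csubspace_graph closed_graph] proj_onto_mem[OF csubspace_graph closed_graph]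
      proj_onto_orth[OF csubspace_graph closed_graph], assumption?)+

lemma PT_eqI: "p \<in> G \<Longrightarrow> (\<And>s. s \<in> G \<Longrightarrow> cinner s (x - p) = 0) \<Longrightarrow> PT x = p"
  unfolding graph_proj_def by (rule proj_onto_eqI[OF csubspace_graph])

lemma PT_fixed: "x \<in> G \<Longrightarrow> PT x = x"
  by (rule PT_eqI) simp_all

lemma PT_J: "PT (J f) = J (f - PT f)"
proof (rule PT_eqI)
  show "J (f - PT f) \<in> G"
    using PT_residual orthogonal_graph_iff_J by blast
  have "\<forall>s\<in>G. cinner s (J (PT f)) = 0"
    unfolding orthogonal_graph_iff_J J_J by (rule PT_mem)
  moreover have "J f - J (f - PT f) = J (PT f)" by (simp add: J_diff)
  ultimately show "cinner s (J f - J (f - PT f)) = 0" if "s \<in> G" for s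
    using that by metis
qed

lemma basis_projection_PT: "basis_projection J PT"
  using PT_orth PT_J by (rule basis_projectionI)

text \<open>The residual \<open>x - P\<^sub>T x\<close> is orthogonal to the graph, that is, annihilated by \<open>P1 + T\<^sup>*\<close>.\<close>

lemma normal_equation: "P1 (P1 (PT x)) + T' (T (P1 (PT x))) = P1 x + T' x"
proof -
  have q: "P1 (PT x) + T (PT x) = PT x" using PT_mem mem_graph_iff by blast
  have "P1 (x - PT x) + T' (x - PT x) = 0"
    using PT_residual orthogonal_graph_iff by blast
  moreover have "T' (PT x) = T' (T (PT x))"
    using arg_cong[OF q, of T'] by (simp add: T'_add)
  ultimately show ?thesis by (simp add: P1_diff T'_diff algebra_simps)
qed

text \<open>Injectivity comes from \<open>\<langle>d, (1 + T\<^sup>*T) d\<rangle> = \<parallel>d\<parallel>\<^sup>2 + \<parallel>T d\<parallel>\<^sup>2\<close>.  For surjectivity, the normal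
  equation at \<open>a \<in> ran P1\<close> exhibits \<open>P1 P\<^sub>T a\<close> as a preimage of \<open>a\<close>.\<close>

lemma bij_betw_gram: "bij_betw (\<lambda>f. P1 f + T' (T f)) (range P1) (range P1)"
  unfolding bij_betw_def
proof
  show "inj_on (\<lambda>f. P1 f + T' (T f)) (range P1)"
  proof (rule inj_onI)
    fix f g assume fg: "f \<in> range P1" "g \<in> range P1" "P1 f + T' (T f) = P1 g + T' (T g)"
    define d where "d = f - g"
    have d: "P1 d = d" using fg(1,2) by (auto simp: d_def P1_diff)
    have "P1 d + T' (T d) = 0"
      using fg(3) by (simp add: d_def P1_diff T_diff T'_diff algebra_simps)
    then have "cinner d d + cinner (T d) (T d) = 0"
      using d by (metis cinner_T cinner_add_right cinner_zero_right)
    then have "complex_of_real ((norm d)\<^sup>2 + (norm (T d))\<^sup>2) = 0" by (simp add: cinner_self)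
    then have "(norm d)\<^sup>2 + (norm (T d))\<^sup>2 = 0" by (simp only: of_real_eq_0_iff)
    then show "f = g" by (simp add: d_def add_nonneg_eq_0_iff)
  qed
  show "(\<lambda>f. P1 f + T' (T f)) ` range P1 = range P1"
  proof
    have "P1 f + T' (T f) = P1 (P1 f + T' (T f))" for f by (simp add: P1_add)
    then show "(\<lambda>f. P1 f + T' (T f)) ` range P1 \<subseteq> range P1" by blast
    show "range P1 \<subseteq> (\<lambda>f. P1 f + T' (T f)) ` range P1"
    proof
      fix a assume "a \<in> range P1"
      then have "a = P1 a" by (simp add: mem_range_P1)
      then have "P1 a + T' a = a" using T'_P1[of a] by simp
      then have "a = P1 (P1 (PT a)) + T' (T (P1 (PT a)))" using normal_equation[of a] by simp
      then show "a \<in> (\<lambda>f. P1 f + T' (T f)) ` range P1" by blast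
    qed
  qed
qed

lemma graph_proj_formula:
  "PT = (\<lambda>f. P1 f + T f) \<circ> inv_into (range P1) (\<lambda>f. P1 f + T' (T f)) \<circ> (\<lambda>f. P1 f + T' f)"
proof
  fix x
  have "inv_into (range P1) (\<lambda>f. P1 f + T' (T f)) (P1 x + T' x) = P1 (PT x)"
    using bij_betw_gram unfolding bij_betw_def
    by (intro inv_into_f_eq) (auto simp only: normal_equation)
  then show "PT x = ((\<lambda>f. P1 f + T f) \<circ> inv_into (range P1) (\<lambda>f. P1 f + T' (T f))
      \<circ> (\<lambda>f. P1 f + T' f)) x"
    using PT_mem[of x] by (simp add: mem_graph_iff)
qed

lemma hilbert_schmidt_PT_diff: "hilbert_schmidt (\<lambda>x. PT x - P1 x)"
proof -
  have eq: "PT x - P1 x = T' x - T' (T (PT x)) + T (PT x)" for x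
  proof -
    have q: "P1 (PT x) + T (PT x) = PT x" using PT_mem mem_graph_iff by blast
    have "P1 (PT x) + T' (T (PT x)) = P1 x + T' x" using normal_equation[of x] by simp
    then have "P1 (PT x) - P1 x = T' x - T' (T (PT x))" by (simp add: algebra_simps)
    moreover have "PT x - P1 x = (P1 (PT x) - P1 x) + T (PT x)"
      by (subst q[symmetric]) simp
    ultimately show ?thesis by simp
  qed
  have TPT: "hilbert_schmidt (\<lambda>x. T (PT x))"
    by (rule hilbert_schmidt_compose_right[OF T_hs orth_projection_bounded[OF PT_orth]])
  show ?thesis
    unfolding eq
    by (rule hilbert_schmidt_sum[OF hilbert_schmidt_diff[OF hilbert_schmidt_cadjoint[OF T_hs]
            hilbert_schmidt_compose_left[OF T'_bounded TPT]] TPT])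
qed

end

section \<open>The pair attached to a basis projection\<close>

locale hs_basis_projection = reference_projection J P1 for J P1 :: "'a::chilbert_space \<Rightarrow> 'a" +
  fixes P :: "'a \<Rightarrow> 'a"
  assumes P_mem: "P \<in> hs_basis_projections J P1"
begin

lemma P_basis: "basis_projection J P" and D_hs: "hilbert_schmidt (\<lambda>f. P1 f - P f)"
  using P_mem by (simp_all add: hs_basis_projections_def)

lemma P_orth: "orth_projection P"
  using P_basis by (simp add: basis_projection_def)

lemmas P_bounded = orth_projection_bounded[OF P_orth]
lemmas P_idem [simp] = orth_projection_idem[OF P_orth]
lemmas P_sym = orth_projection_sym[OF P_orth]
lemmas P_add = bounded_clinear_add[OF P_bounded]
lemmas P_diff = bounded_clinear_diff[OF P_bounded]
lemmas P_zero = bounded_clinear_zero[OF P_bounded]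
lemmas P_J = basis_projection_J[OF P_basis]

abbreviation P11 where "P11 \<equiv> block P1 P P1"
abbreviation N where "N \<equiv> ker_on (range P1) P11"
abbreviation M where "M \<equiv> ker_complement P1 P11"

lemma block_apply: "block R A Q f = R (A (Q f))"
  by (simp add: block_def)

lemmas P11_apply = block_apply[of P1 P P1]

lemma bounded_clinear_P11: "bounded_clinear P11"
  unfolding block_def comp_def
  by (rule bounded_clinear_compose[OF P1_bounded bounded_clinear_compose[OF P_bounded P1_bounded]])

lemma norm_P_power2:
  assumes "P1 f = f"
  shows "complex_of_real ((norm (P f))\<^sup>2) = cinner f (P11 f)"
  by (simp only: norm_projection_power2[OF P_orth] P11_apply assms cinner_P1_left[OF assms])

text \<open>\<open>P\<^sub>1\<^sub>1\<close> has no larger kernel than \<open>P\<close> on \<open>ran P1\<close>, as \<open>\<langle>n, P\<^sub>1\<^sub>1 n\<rangle> = \<parallel>P n\<parallel>\<^sup>2\<close> there.\<close>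

lemma kernel_iff: "n \<in> N \<longleftrightarrow> P1 n = n \<and> P n = 0"
proof
  assume "n \<in> N"
  then have n: "P1 n = n" "P11 n = 0" by (auto simp: ker_on_def)
  then have "complex_of_real ((norm (P n))\<^sup>2) = 0" using norm_P_power2[OF n(1)] by simp
  then show "P1 n = n \<and> P n = 0" using n by simp
qed (auto simp: ker_on_def P11_apply P1_zero mem_range_P1)

lemma ker_complement_iff: "f \<in> M \<longleftrightarrow> P1 f = f \<and> (\<forall>n\<in>N. cinner n f = 0)"
  by (auto simp: ker_complement_def mem_range_P1)

text \<open>On the kernel \<open>P1 - P\<close> is the identity, so the Hilbert-Schmidt bound limits the number of
  orthonormal vectors there.\<close>

lemma finite_cdim_kernel: "finite_cdim N"
proof -
  obtain C where C: "\<And>F. finite F \<Longrightarrow> orthonormal F \<Longrightarrow> (\<Sum>f\<in>F. (norm (P1 f - P f))\<^sup>2) \<le> C"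
    using hilbert_schmidt_hs_bounded[OF D_hs] by (auto simp: hs_bounded_def)
  show ?thesis
  proof (rule finite_cdimI_card_bound)
    show "csubspace N"
      by (rule complex_vector.subspaceI)
        (auto simp: kernel_iff P1_zero P_zero P1_add P_add bounded_clinear_scaleC[OF P1_bounded]
          bounded_clinear_scaleC[OF P_bounded])
    fix F assume F: "finite F" "orthonormal F" "F \<subseteq> N"
    have "real (card F) = (\<Sum>f\<in>F. (norm (P1 f - P f))\<^sup>2)"
      using F(2,3) by (subst sum.cong[OF refl, of _ _ "\<lambda>_. 1"]) (auto simp: kernel_iff orthonormal_def)
    also have "\<dots> \<le> C" using F(1,2) by (rule C)
    finally show "card F \<le> nat \<lfloor>C\<rfloor>" by (simp add: le_nat_floor)
  qed
qed

text \<open>Off finitely many directions \<open>P1 - P\<close> has norm at most \<open>1/2\<close>, so there \<open>\<parallel>P f\<parallel> \<ge> \<parallel>f\<parallel> / 2\<close> and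
  \<open>\<parallel>P11 f\<parallel> \<parallel>f\<parallel> \<ge> \<langle>f, P f\<rangle> = \<parallel>P f\<parallel>\<^sup>2 \<ge> \<parallel>f\<parallel>\<^sup>2 / 4\<close>.\<close>

lemma P11_bounded_below: "\<exists>c>0. \<forall>f\<in>M. c * norm f \<le> norm (P11 f)"
proof -
  obtain F where F: "finite F"
      "\<And>x. (\<And>f. f \<in> F \<Longrightarrow> cinner f x = 0) \<Longrightarrow> norm (P1 x - P x) \<le> 1/2 * norm x"
    using hs_bounded_small_off_finite[OF hilbert_schmidt_hs_bounded[OF D_hs]
        hilbert_schmidt_bounded_clinear[OF D_hs], of "1/2"] by auto
  show ?thesis
  proof (rule bounded_below_if_bounded_below_off_finite[OF bounded_clinear_P11 F(1), where c = "1/4"])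
    show "csubspace M" "closed M"
      by (rule csubspace_ker_complement[OF P1_orth] closed_ker_complement[OF P1_orth])+
    show "f = 0" if "f \<in> M" "P11 f = 0" for f
      using that by (auto simp: ker_complement_def ker_on_def)
    fix f assume f: "f \<in> M" "\<forall>e\<in>F. cinner e f = 0"
    have P1f: "P1 f = f" using f(1) by (simp add: ker_complement_iff)
    have "norm f \<le> norm (P f) + norm (f - P f)"
      using norm_triangle_ineq[of "P f" "f - P f"] by simp
    moreover have "norm (f - P f) \<le> 1/2 * norm f" using F(2)[of f] f(2) P1f by simp
    ultimately have "norm f / 2 \<le> norm (P f)" by simp
    then have "(norm f / 2)\<^sup>2 \<le> (norm (P f))\<^sup>2" by (intro power_mono) auto
    also have "(norm (P f))\<^sup>2 \<le> norm f * norm (P11 f)"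
      using norm_cinner_le[of f "P11 f"] unfolding norm_P_power2[OF P1f, symmetric]
      by (simp add: norm_power)
    finally have "norm f * (1/4 * norm f) \<le> norm f * norm (P11 f)"
      by (simp add: power2_eq_square)
    then show "1/4 * norm f \<le> norm (P11 f)"
      by (cases "f = 0") (simp_all add: mult_le_cancel_left)
  qed simp
qed

sublocale P11: self_adjoint_bounded_below P1 P11
proof
  show "cinner (P11 f) g = cinner f (P11 g)" for f g
    by (simp add: P11_apply P1_sym P_sym)
qed (use P1_orth bounded_clinear_P11 P11_bounded_below in \<open>simp_all add: P11_apply\<close>)

abbreviation S where "S \<equiv> range_inverse P1 P11"

lemma P1_S [simp]: "P1 (S f) = S f"
  using P11.range_inverse_mem[of f] by (simp add: ker_complement_iff)

definition T :: "'a \<Rightarrow> 'a" where "T = block (compl_proj P1) P P1 \<circ> S"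

lemma pair_of_proj_eq: "pair_of_proj P1 P = (T, N)"
  by (simp add: pair_of_proj_def T_def)

lemma T_apply: "T f = P (S f) - P11 (S f)"
  by (simp add: T_def block_apply compl_proj_def)

lemma T_hs: "hilbert_schmidt T"
proof -
  have eq: "T = (\<lambda>f. (\<lambda>g. P1 g - g) (P1 (S f) - P (S f)))"
    by (simp add: fun_eq_iff T_apply P11_apply P1_diff)
  have "hilbert_schmidt (\<lambda>f. P1 (S f) - P (S f))"
    by (rule hilbert_schmidt_compose_right[OF D_hs P11.bounded_clinear_range_inverse])
  then show ?thesis
    unfolding eq
    by (rule hilbert_schmidt_compose_left[OF bounded_clinear_sub[OF P1_bounded bounded_clinear_ident]])
qed

lemma P1_T [simp]: "P1 (T f) = 0" and T_P1: "T (P1 f) = T f"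
  by (simp_all add: T_apply P11_apply P1_diff range_inverse_projection[OF P1_orth])

lemma J_kernel: "n \<in> N \<Longrightarrow> P1 (J n) = 0 \<and> P (J n) = J n"
  by (simp add: kernel_iff P1_J P_J)

lemma J_mem_kernel: "P1 w = 0 \<Longrightarrow> P w = w \<Longrightarrow> J w \<in> N"
  by (simp add: kernel_iff P1_J P_J)

text \<open>Together with \<open>P_mem_graph\<close> and \<open>T_kernel\<close> this identifies the graph of \<open>T\<close> with \<open>P M + N\<close>.\<close>

lemma graph_decomposition:
  obtains g n where "g \<in> M" "n \<in> N" "P1 f + T f = P g + n"
proof
  show "S f \<in> M" "P1 f - P11 (S f) \<in> N"
    by (rule P11.range_inverse_mem P11.range_inverse_residual)+
  show "P1 f + T f = P (S f) + (P1 f - P11 (S f))"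
    by (simp add: T_apply)
qed

lemma P_mem_graph:
  assumes "g \<in> M"
  shows "P1 (P g) + T (P g) = P g"
proof -
  have g: "P1 g = g" using assms by (simp add: ker_complement_iff)
  have "S (P g) = g"
    using assms by (intro P11.range_inverse_eqI) (simp_all add: P11_apply g kernel_iff P1_zero P_zero)
  then show ?thesis by (simp add: T_apply P11_apply g)
qed

lemma T_kernel:
  assumes "n \<in> N"
  shows "T n = 0"
proof -
  have "S n = 0"
    using assms
    by (intro P11.range_inverse_eqI)
      (simp_all add: kernel_iff ker_complement_iff P11_apply P1_zero P_zero)
  then show ?thesis by (simp add: T_apply P11_apply P1_zero P_zero)
qed

text \<open>The graph of \<open>T\<close> is isotropic for the form \<open>\<langle>J u, v\<rangle>\<close>, because both \<open>P M\<close> and \<open>N\<close>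
  are isotropic and orthogonal to each other for this form: \<open>J\<close> maps the range of a basis projection
  to its orthogonal complement.\<close>

lemma T_antisymmetric: "antisymmetric_op J T"
proof -
  have "cinner (J f) (T g) = - cinner (J g) (T f)" for f g
  proof -
    obtain a n where a: "a \<in> M" "n \<in> N" "P1 f + T f = P a + n" by (rule graph_decomposition)
    obtain b m where b: "b \<in> M" "m \<in> N" "P1 g + T g = P b + m" by (rule graph_decomposition)
    have cross: "cinner (J k) (P c) = 0" if "k \<in> N" "c \<in> M" for k c
    proof -
      have "cinner (J k) (P c) = cinner (J k) c"
        using J_kernel[OF that(1)] P_sym[of "J k" c] by simp
      also have "\<dots> = 0"
        using J_kernel[OF that(1)] that(2) orthogonal_P1_kernel[of c "J k"] by (simp add: ker_complement_iff)
      finally show ?thesis .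
    qed
    have "cinner (J (P a)) (P b) = 0"
      unfolding P_sym[symmetric] P_J by simp
    moreover have "cinner (J (P a)) m = 0"
      using cross[OF b(2) a(1)] cinner_J_left[of "P a" m] by simp
    moreover have "cinner (J n) m = 0"
      using J_kernel[OF a(2)] b(2) orthogonal_P1_kernel[of m "J n"] by (simp add: kernel_iff)
    ultimately have "cinner (J (P1 f + T f)) (P1 g + T g) = 0"
      unfolding a(3) b(3) J_add cinner_add_left cinner_add_right
      using cross[OF a(2) b(1)] by simp
    moreover have "cinner (J (P1 f)) (P1 g) = 0"
      using orthogonal_P1_kernel[of "P1 g" "J (P1 f)"] by (simp add: P1_J)
    moreover have "cinner (J (T f)) (T g) = 0"
      using orthogonal_P1_kernel[of "J (T f)" "T g"] by (simp add: P1_J)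
    moreover have "cinner (J (P1 h)) (T k) = cinner (J h) (T k)" for h k
    proof -
      have "J (P1 h) = J h - P1 (J h)" by (simp add: P1_J J_diff)
      then show ?thesis by (simp add: cinner_diff_left P1_sym)
    qed
    moreover have "cinner (J (T f)) (P1 g) = cinner (J (P1 g)) (T f)" by (rule cinner_J_left)
    ultimately show ?thesis
      by (simp add: J_add cinner_add_left cinner_add_right eq_neg_iff_add_eq_0 add.commute)
  qed
  then show ?thesis
    using antisymmetric_op_iff[OF hilbert_schmidt_bounded_clinear[OF T_hs]] by blast
qed

lemma T_mem_hs_antisymmetric: "T \<in> hs_antisymmetric J P1"
  using block_off_diagonal_iff[of T] T_P1 T_hs T_antisymmetric by (simp add: hs_antisymmetric_def)

lemma pair_of_proj_mem: "pair_of_proj P1 P \<in> hs_pairs J P1"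
  using T_mem_hs_antisymmetric P11.csubspace_kernel finite_cdim_kernel T_kernel
  by (auto simp: pair_of_proj_eq hs_pairs_def ker_on_def)

sublocale graph: antisymmetric_hs J P1 T
  by unfold_locales (rule T_mem_hs_antisymmetric)

text \<open>The operator \<open>P + p\<^sub>N - p\<^bsub>J N\<^esub>\<close> is the projection onto the graph \<open>P M + N\<close>, because the range of \<open>P\<close>
  is the orthogonal sum of \<open>P M\<close> and \<open>J N\<close>.\<close>

lemma proj_of_pair_of_proj: "proj_of_pair J P1 (pair_of_proj P1 P) = P"
proof
  fix f
  define p where "p = proj_onto N"
  note sub = P11.csubspace_kernel P11.closed_kernel
  have p_mem: "p x \<in> N" and p_res: "n \<in> N \<Longrightarrow> cinner n (x - p x) = 0" for n x
    unfolding p_def by (rule proj_onto_mem[OF sub] proj_onto_orth[OF sub], assumption?)+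
  define c where "c = p (J f)"
  have cN: "c \<in> N" by (simp add: c_def p_mem)
  note Jc = J_kernel[OF cN]
  \<comment> \<open>The vector \<open>J c\<close> is the projection of \<open>f\<close> to \<open>J N\<close>.  It is to be shown that \<open>h\<close>, the part of
    \<open>P f\<close> orthogonal to \<open>J N\<close>, belongs to \<open>P M\<close>; the candidate \<open>P g\<close> is determined by its
    \<open>P1\<close>-component.\<close>
  define h where "h = P f - J c"
  have Ph: "P h = h" using Jc by (simp add: h_def P_diff)
  have J_h: "cinner (J k) h = 0" if k: "k \<in> N" for k
  proof -
    have "cinner (J k) (P f) = cinner (J k) f" using J_kernel[OF k] P_sym[of "J k" f] by simp
    then have "cinner (J k) h = cinner (J k) f - cinner (J k) (J c)"
      by (simp add: h_def cinner_diff_right)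
    also have "\<dots> = cinner (J f - c) k"
      by (simp add: cinner_diff_left cinner_J_J cinner_J_left[of k f])
    also have "\<dots> = 0" using p_res[OF k, of "J f"] by (simp add: c_def cinner_eq_0_commute)
    finally show ?thesis .
  qed
  have "cinner n (P1 h) = 0" if "n \<in> N" for n
  proof -
    have n: "P1 n = n" "P n = 0" using that by (simp_all add: kernel_iff)
    have "cinner n (P1 h) = cinner n (P h)" by (simp add: cinner_P1_left n(1) Ph)
    also have "\<dots> = cinner (P n) h" by (rule P_sym[symmetric])
    finally show ?thesis by (simp add: n(2))
  qed
  then have "P1 h \<in> M" by (simp add: ker_complement_iff)
  then obtain g where g: "g \<in> M" "P1 h = P11 g" using P11.image_ker_complement by blast
  have P1g: "P1 g = g" using g(1) by (simp add: ker_complement_iff)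
  define w where "w = P g - h"
  \<comment> \<open>The error \<open>w\<close> lies in \<open>ran P \<inter> ker P1 = J N\<close> and is orthogonal to \<open>J N\<close>.\<close>
  have "J w \<in> N"
    by (rule J_mem_kernel) (simp_all add: w_def P1_diff P_diff Ph g(2) P11_apply P1g)
  have "cinner (J k) (P g) = 0" if "k \<in> N" for k
    using J_kernel[OF that] P_sym[of "J k" g] orthogonal_P1_kernel[OF P1g, of "J k"] by simp
  then have "cinner (J (J w)) w = 0"
    using \<open>J w \<in> N\<close> J_h by (simp only: w_def cinner_diff_right) simp
  then have h_eq: "h = P g" by (simp add: w_def)
  have "graph.PT f = P f + p f - J c"
  proof (rule graph.PT_eqI)
    have "P g \<in> graph.G" using P_mem_graph[OF g(1)] by (simp add: graph.mem_graph_iff)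
    moreover have "p f \<in> graph.G"
      using p_mem[of f] T_kernel[of "p f"] by (simp add: graph.mem_graph_iff kernel_iff)
    ultimately have "h + p f \<in> graph.G"
      unfolding h_eq using graph.csubspace_graph complex_vector.subspace_add by blast
    then show "P f + p f - J c \<in> graph.G" by (simp add: h_def algebra_simps)
    fix s assume "s \<in> graph.G"
    then obtain x where "s = P1 x + T x" by blast
    then obtain a n where a: "a \<in> M" "n \<in> N" "s = P a + n" by (metis graph_decomposition)
    have P1a: "P1 a = a" using a(1) by (simp add: ker_complement_iff)
    have n: "P1 n = n" "P n = 0" using a(2) by (simp_all add: kernel_iff)
    have pf: "P (p f) = 0" using p_mem[of f] by (simp add: kernel_iff)
    have "cinner (P a) (f - (P f + p f - J c)) = cinner a (P (f - (P f + p f - J c)))"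
      by (rule P_sym)
    also have "\<dots> = cinner a (J c)" using Jc by (simp add: P_diff P_add pf)
    also have "\<dots> = 0" using Jc orthogonal_P1_kernel[OF P1a] by simp
    finally have PM: "cinner (P a) (f - (P f + p f - J c)) = 0" .
    have "cinner n (f - p f) = 0" by (rule p_res[OF a(2)])
    moreover have "cinner n (P f) = 0" using P_sym[of n f] n(2) by simp
    moreover have "cinner n (J c) = 0" using Jc orthogonal_P1_kernel[OF n(1)] by simp
    ultimately have N: "cinner n (f - (P f + p f - J c)) = 0"
      by (simp add: cinner_diff_right cinner_add_right)
    show "cinner s (f - (P f + p f - J c)) = 0"
      unfolding a(3) cinner_add_left by (simp only: PM N add_0)
  qed
  then show "proj_of_pair J P1 (pair_of_proj P1 P) f = P f"
    by (simp add: pair_of_proj_eq proj_of_pair_def conj_op_def c_def p_def)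
qed

end

section \<open>The basis projection attached to a pair\<close>

locale hs_pair = antisymmetric_hs J P1 T for J P1 T :: "'a::chilbert_space \<Rightarrow> 'a" +
  fixes h :: "'a set"
  assumes h_sub: "csubspace h" and h_fin: "finite_cdim h" and h_ker: "h \<subseteq> ker_on (range P1) T"
begin

abbreviation p where "p \<equiv> proj_onto h"

lemmas h_closed = closed_finite_cdim[OF h_fin]
lemmas p_orth = orth_projection_proj_onto[OF h_sub h_closed]
lemmas p_bounded = orth_projection_bounded[OF p_orth]
lemmas p_mem = proj_onto_mem[OF h_sub h_closed]
lemmas p_residual = proj_onto_orth[OF h_sub h_closed]
lemmas p_add = bounded_clinear_add[OF p_bounded]
lemmas p_diff = bounded_clinear_diff[OF p_bounded]
lemmas PT_bounded = orth_projection_bounded[OF PT_orth]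
lemmas PT_add = bounded_clinear_add[OF PT_bounded]
lemmas PT_diff = bounded_clinear_diff[OF PT_bounded]

lemma h_P1: "k \<in> h \<Longrightarrow> P1 k = k" and h_T: "k \<in> h \<Longrightarrow> T k = 0"
  using h_ker by (auto simp: ker_on_def)

lemma h_graph: "k \<in> h \<Longrightarrow> k \<in> G"
  by (simp add: mem_graph_iff h_P1 h_T)

lemma p_zeroI: "(\<And>k. k \<in> h \<Longrightarrow> cinner k x = 0) \<Longrightarrow> p x = 0"
  by (rule proj_onto_eqI[OF h_sub]) (simp_all add: complex_vector.subspace_0[OF h_sub])

lemma p_J_zero: "P1 x = x \<Longrightarrow> p (J x) = 0"
  by (rule p_zeroI) (simp add: orthogonal_P1_kernel h_P1 P1_J_fixed)

abbreviation P where "P \<equiv> proj_of_pair J P1 (T, h)"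

lemma P_apply: "P f = PT f - p f + J (p (J f))"
  by (simp add: proj_of_pair_def conj_op_def)

lemma P_eq: "P = (\<lambda>f. PT f - p f + conj_op J p f)"
  by (simp add: fun_eq_iff P_apply conj_op_def)

lemma PT_p: "PT (p f) = p f"
  by (rule PT_fixed[OF h_graph[OF p_mem]])

lemma p_PT: "p (PT f) = p f"
proof (rule proj_onto_eqI[OF h_sub p_mem])
  fix k assume k: "k \<in> h"
  have "cinner k (PT f - f) = 0"
    using PT_residual[OF h_graph[OF k], of f] by (simp add: cinner_diff_right)
  then show "cinner k (PT f - p f) = 0"
    using p_residual[OF k, of f] by (simp add: cinner_diff_right)
qed

lemma p_p: "p (p f) = p f"
  by (rule orth_projection_idem[OF p_orth])

lemma PT_J_p: "PT (J (p f)) = 0"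
  by (simp add: PT_J PT_p)

lemma p_J_PT: "p (J (PT f)) = 0"
proof (rule p_zeroI)
  fix k assume "k \<in> h"
  then show "cinner k (J (PT f)) = 0"
    using PT_mem[of f] orthogonal_graph_iff_J[of "J (PT f)"] h_graph by (simp only: J_J) blast
qed

lemma p_J_p: "p (J (p f)) = 0"
  by (rule p_J_zero[OF h_P1[OF p_mem]])

text \<open>The range of \<open>p\<close> lies in the graph, that of its conjugate in the orthogonal complement of the
  graph, so the three projections commute and the range of the first summand is altered by removing
  \<open>h\<close> and adding \<open>J h\<close>.\<close>

lemma orth_projection_P: "orth_projection P"
  unfolding orth_projection_iff
proof (intro conjI allI)
  note c = orth_projection_conj_op[OF p_orth]
  show "bounded_clinear P"
    unfolding P_eq
    by (rule bounded_clinear_sum[OF bounded_clinear_sub[OF PT_bounded p_bounded]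
          orth_projection_bounded[OF c]])
  fix f g
  show "P (P f) = P f"
    unfolding P_apply[of f] P_apply[of "PT f - p f + J (p (J f))"]
    by (simp add: PT_add PT_diff p_add p_diff J_add J_diff orth_projection_idem[OF PT_orth]
        PT_p p_PT p_p PT_J_p p_J_PT p_J_p)
  show "cinner (P f) g = cinner f (P g)"
    unfolding P_eq
    by (simp add: cinner_add_left cinner_diff_left cinner_add_right cinner_diff_right
        orth_projection_sym[OF PT_orth] orth_projection_sym[OF p_orth] orth_projection_sym[OF c])
qed

lemma P_mem: "P \<in> hs_basis_projections J P1"
proof -
  have "basis_projection J P"
    using orth_projection_P
    by (rule basis_projectionI) (simp add: P_apply PT_J J_add J_diff)
  moreover have "hilbert_schmidt (\<lambda>f. P1 f - P f)"
  proof -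
    obtain E :: "'a set" where E: "is_onb E" using hilbert_schmidt_onb[OF T_hs] by blast
    note p = hilbert_schmidt_projection_finite_cdim[OF h_sub h_fin E]
    have "(\<lambda>f. P1 f - P f) = (\<lambda>f. (p f - conj_op J p f) - (PT f - P1 f))"
      by (simp add: fun_eq_iff P_eq)
    then show ?thesis
      using hilbert_schmidt_diff[OF hilbert_schmidt_diff[OF p hilbert_schmidt_conj_op[OF p]]
          hilbert_schmidt_PT_diff] by simp
  qed
  ultimately show ?thesis by (simp add: hs_basis_projections_def)
qed

sublocale hs: hs_basis_projection J P1 P
  by unfold_locales (rule P_mem)

text \<open>On \<open>ran P1\<close> the summand \<open>J p J\<close> vanishes, so \<open>P f = 0\<close> there means \<open>P\<^sub>T f = p f\<close>; then \<open>f - p f\<close> is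
  a vector of \<open>ran P1\<close> orthogonal to the graph, hence zero.\<close>

lemma kernel_P: "hs.N = h"
proof
  show "h \<subseteq> hs.N"
  proof
    fix k assume k: "k \<in> h"
    have "p k = k" using proj_onto_eqI[OF h_sub k] by simp
    then have "P k = 0"
      using k by (simp add: P_apply PT_fixed h_graph p_J_zero h_P1)
    then show "k \<in> hs.N" using k by (simp add: hs.kernel_iff h_P1)
  qed
  show "hs.N \<subseteq> h"
  proof
    fix f assume "f \<in> hs.N"
    then have f: "P1 f = f" "P f = 0" by (simp_all add: hs.kernel_iff)
    have "PT f = p f" using f(2) by (simp add: P_apply p_J_zero[OF f(1)])
    then have "P1 (f - p f) + T' (f - p f) = 0"
      using PT_residual orthogonal_graph_iff by metis
    moreover have d: "P1 (f - p f) = f - p f" by (simp add: P1_diff f(1) h_P1 p_mem)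
    moreover have "T' (f - p f) = 0" using T'_P1[of "f - p f"] d by simp
    ultimately have "f = p f" by simp
    then show "f \<in> h" using p_mem[of f] by simp
  qed
qed

text \<open>On the complement of \<open>h\<close> in \<open>ran P1\<close> the operators \<open>P\<close> and \<open>P\<^sub>T\<close> agree, and \<open>P\<^sub>T\<close> takes values in
  the graph of \<open>T\<close>.\<close>

lemma pair_of_proj_P: "pair_of_proj P1 P = (T, h)"
proof -
  have "hs.T f = T f" for f
  proof -
    define g where "g = hs.S f"
    have P1g: "P1 g = g" by (simp add: g_def)
    have "cinner k g = 0" if "k \<in> h" for k
      using hs.P11.range_inverse_mem[of f] that unfolding hs.ker_complement_iff kernel_P g_def by blast
    then have "p g = 0" by (rule p_zeroI)
    then have Pg: "P g = PT g" by (simp add: P_apply p_J_zero[OF P1g])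
    have "P1 (PT g) + T (PT g) = PT g" using PT_mem mem_graph_iff by blast
    then have "PT g - P1 (PT g) = T (P1 (PT g))" by (simp add: algebra_simps)
    then have "hs.T f = T (hs.P11 g)"
      by (simp add: hs.T_apply g_def[symmetric] hs.P11_apply P1g Pg)
    moreover have "P1 f - hs.P11 g \<in> h"
      using hs.P11.range_inverse_residual[of f] unfolding g_def kernel_P .
    then have "T (P1 f) - T (hs.P11 g) = 0" by (simp only: T_diff[symmetric] h_T)
    ultimately show ?thesis by simp
  qed
  then show ?thesis by (simp add: hs.pair_of_proj_eq kernel_P fun_eq_iff)
qed

end

section \<open>The bijection\<close>

theorem proposition2p9:
  fixes J P1 :: "'a::chilbert_space \<Rightarrow> 'a"
  assumes "separable_type TYPE('a)"
    and "\<not> finite_cdim (UNIV :: 'a set)"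
    and "conjugation J"
    and "basis_projection J P1"
  shows "(\<forall>P \<in> hs_basis_projections J P1.
            let P11 = block P1 P P1; R = P11 ` range P1 in
              closed R \<and> finite_cdim (ker_on (range P1) P11) \<and> bij_betw P11 R R \<and>
              bounded_clinear (range_inverse P1 P11))
       \<and> (\<forall>T \<in> hs_antisymmetric J P1.
            basis_projection J (graph_proj P1 T) \<and>
            range (graph_proj P1 T) = (\<lambda>f. P1 f + T f) ` range P1 \<and>
            bij_betw (\<lambda>f. P1 f + cadjoint T (T f)) (range P1) (range P1) \<and>
            graph_proj P1 T =
              (\<lambda>f. P1 f + T f) \<circ>
              inv_into (range P1) (\<lambda>f. P1 f + cadjoint T (T f)) \<circ>
              (\<lambda>f. P1 f + cadjoint T f))
       \<and> bij_betw (pair_of_proj P1) (hs_basis_projections J P1) (hs_pairs J P1)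
       \<and> (\<forall>x \<in> hs_pairs J P1.
            inv_into (hs_basis_projections J P1) (pair_of_proj P1) x = proj_of_pair J P1 x)"
proof -
  interpret reference_projection J P1
    using assms(3,4) by unfold_locales
  have proj: "hs_basis_projection J P1 P" if "P \<in> hs_basis_projections J P1" for P
    using that by unfold_locales
  have graph: "antisymmetric_hs J P1 T" if "T \<in> hs_antisymmetric J P1" for T
    using that by unfold_locales
  have pair: "hs_pair J P1 T h" if "(T, h) \<in> hs_pairs J P1" for T h
    using that by unfold_locales (auto simp: hs_pairs_def)
  have block: "let P11 = block P1 P P1; R = P11 ` range P1 in
      closed R \<and> finite_cdim (ker_on (range P1) P11) \<and> bij_betw P11 R R \<and>
      bounded_clinear (range_inverse P1 P11)" if "P \<in> hs_basis_projections J P1" for P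
  proof -
    interpret hs_basis_projection J P1 P by (rule proj[OF that])
    show ?thesis
      unfolding Let_def P11.image_range
      by (intro conjI closed_ker_complement[OF P1_orth] finite_cdim_kernel P11.bij_betw_ker_complement
          P11.bounded_clinear_range_inverse)
  qed
  have bij: "bij_betw (pair_of_proj P1) (hs_basis_projections J P1) (hs_pairs J P1)"
    by (rule bij_betw_byWitness[where f' = "proj_of_pair J P1"])
      (auto intro: hs_basis_projection.proj_of_pair_of_proj[OF proj] hs_pair.pair_of_proj_P[OF pair]
        hs_basis_projection.pair_of_proj_mem[OF proj] hs_pair.P_mem[OF pair])
  have inv: "inv_into (hs_basis_projections J P1) (pair_of_proj P1) x = proj_of_pair J P1 x"
    if "x \<in> hs_pairs J P1" for x
  proof -
    obtain T h where x: "x = (T, h)" by (cases x)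
    with that have Th: "(T, h) \<in> hs_pairs J P1" by simp
    show ?thesis
      unfolding x using bij_betw_imp_inj_on[OF bij] hs_pair.P_mem[OF pair[OF Th]]
        hs_pair.pair_of_proj_P[OF pair[OF Th]]
      by (metis inv_into_f_f)
  qed
  show ?thesis
    using block bij inv antisymmetric_hs.basis_projection_PT[OF graph]
      antisymmetric_hs.range_PT[OF graph] antisymmetric_hs.bij_betw_gram[OF graph]
      antisymmetric_hs.graph_proj_formula[OF graph]
    by (intro conjI ballI)
qed

end
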